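(* Assume GCH. Then: (1) SPL implies CLS; (2) CLS implies wFN; (3) wFN implies SAT; (4) wFN implies Nt; (5) wFN implies HnT. Here the principles are: (SPL) there is a splendid space of cardinality $\aleph_{\omega+1}$; (CLS) there is a family $\mathcal A\subseteq[\aleph_\omega]^\omega$ which is cofinal in $\langle[\aleph_\omega]^\omega,\subseteq\rangle$ and locally small; (wFN) the poset $\langle[\aleph_\omega]^\omega,\subseteq\rangle$ has the weak Freese–Nation property; (SAT) there is a saturated almost disjoint family $\mathcal A\subseteq[\aleph_\omega]^\omega$; (Nt) $\mathrm{Nt}\big((D(2)^{\aleph_\omega})_\delta\big)=\omega_1$; (HnT) there is a permutation group on $\aleph_\omega$ which is $\omega$-homogeneous but not $\omega$-transitive.
   Context: $[S]^\omega$ denotes the family of countably infinite subsets of $S$; $x\subseteq^* y$ means $x\setminus y$ is finite. A regular space $X$ is splendid if it is countably compact, locally countable (every point has a countable open neighbourhood) and $\omega$-fair: $|\overline Y|=\omega$ for every $Y\in[X]^\omega$. A family $\mathcal A\subseteq[\kappa]^\omega$ is locally small if $\{X\cap A:A\in\mathcal A\}$ is countable for every $X\in[\kappa]^\omega$. A poset $\langle P,\le\rangle$ has the weak Freese–Nation property if there is a function $F$ assigning to each $p\in P$ a countable subset $F(p)\subseteq P$ such that for all $p\le q$ in $P$ there is $r\in F(p)\cap F(q)$ with $p\le r\le q$. An almost disjoint family (pairwise intersections finite) $\mathcal A\subseteq[\kappa]^\omega$ is saturated if for every $X\in[\kappa]^\omega$ either there is $A\in\mathcal A$ with $A\subseteq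 X$, or $X\subseteq^*\bigcup\mathcal A'$ for some finite $\mathcal A'\subseteq\mathcal A$. The Noetherian type $\mathrm{Nt}(X)$ of a space $X$ is the least cardinal $\kappa$ such that $X$ has a base $\mathcal B$ with $|\{B'\in\mathcal B: B\subseteq B'\}|<\kappa$ for every $B\in\mathcal B$. $D(2)$ is the two-point discrete space, $D(2)^{\aleph_\omega}$ carries the product topology, and for a space $X$, its $G_\delta$-modification $X_\delta$ is the space on the same set whose topology is generated by all $G_\delta$ subsets of $X$. A permutation group $G$ on an uncountable set $A$ is $\omega$-homogeneous if for all $X,Y\in[A]^\omega$ there is $g\in G$ with $g''X=Y$; it is $\omega$-transitive if for every injective function $f$ with $\mathrm{dom}(f)\cup\mathrm{ran}(f)\in[A]^\omega$ there is $g\in G$ with $f\subseteq g$. *)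

theory Defs
  imports "HOL-Analysis.Analysis" "HOL-Algebra.Bij"
begin

unbundle cardinal_syntax

definition GCH_on :: "'a set \<Rightarrow> bool" where
  "GCH_on U \<longleftrightarrow> (\<forall>A. A \<subseteq> U \<and> infinite A \<longrightarrow> card_of (Pow A) =o cardSuc (card_of A))"

fun is_aleph :: "nat \<Rightarrow> 'a set \<Rightarrow> bool" where
  "is_aleph 0 A \<longleftrightarrow> card_of A =o natLeq"
| "is_aleph (Suc n) A \<longleftrightarrow> (\<exists>B :: 'a set. is_aleph n B \<and> card_of A =o cardSuc (card_of B))"

definition above_all_alephs :: "'a set \<Rightarrow> bool" where
  "above_all_alephs A \<longleftrightarrow> (\<forall>n. \<exists>B :: 'a set. is_aleph n B \<and> card_of B <o card_of A)"

definition is_aleph_omega :: "'a set \<Rightarrow> bool" where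
  "is_aleph_omega A \<longleftrightarrow> above_all_alephs A \<and>
     (\<forall>C :: 'a set. above_all_alephs C \<longrightarrow> card_of A \<le>o card_of C)"

definition ctbl_subsets :: "'a set \<Rightarrow> 'a set set" where
  "ctbl_subsets S = {X. X \<subseteq> S \<and> countable X \<and> infinite X}"

definition countably_compact_space :: "'a topology \<Rightarrow> bool" where
  "countably_compact_space X \<longleftrightarrow>
     (\<forall>\<U>. countable \<U> \<and> (\<forall>U\<in>\<U>. openin X U) \<and> topspace X \<subseteq> \<Union>\<U> \<longrightarrow>
        (\<exists>\<F>. \<F> \<subseteq> \<U> \<and> finite \<F> \<and> topspace X \<subseteq> \<Union>\<F>))"

definition locally_countable :: "'a topology \<Rightarrow> bool" where
  "locally_countable X \<longleftrightarrow> (\<forall>x\<in>topspace X. \<exists>U. openin X U \<and> x \<in> U \<and> countable U)"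

definition omega_fair :: "'a topology \<Rightarrow> bool" where
  "omega_fair X \<longleftrightarrow> (\<forall>Y \<in> ctbl_subsets (topspace X).
      countable (X closure_of Y) \<and> infinite (X closure_of Y))"

text \<open>Regular is taken in the T_3 sense (regular + T_1).\<close>
definition splendid :: "'a topology \<Rightarrow> bool" where
  "splendid X \<longleftrightarrow> regular_space X \<and> t1_space X \<and> countably_compact_space X
     \<and> locally_countable X \<and> omega_fair X"

text \<open>SPL: a splendid space of cardinality aleph_(omega+1) = card_of K^+ (K of size aleph_omega),
  with underlying set taken in the type 'b.\<close>
definition SPL :: "'a set \<Rightarrow> 'b itself \<Rightarrow> bool" where
  "SPL K _ \<longleftrightarrow> (\<exists>X :: 'b topology. splendid X \<and> card_of (topspace X) =o cardSuc (card_of K))"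

definition locally_small :: "'a set \<Rightarrow> 'a set set \<Rightarrow> bool" where
  "locally_small K \<A> \<longleftrightarrow> (\<forall>X \<in> ctbl_subsets K. countable ((\<lambda>A. X \<inter> A) ` \<A>))"

definition CLS :: "'a set \<Rightarrow> bool" where
  "CLS K \<longleftrightarrow> (\<exists>\<A>. \<A> \<subseteq> ctbl_subsets K
      \<and> (\<forall>X \<in> ctbl_subsets K. \<exists>A\<in>\<A>. X \<subseteq> A)
      \<and> locally_small K \<A>)"

definition weak_Freese_Nation :: "'p set \<Rightarrow> ('p \<Rightarrow> 'p \<Rightarrow> bool) \<Rightarrow> bool" where
  "weak_Freese_Nation P leq \<longleftrightarrow> (\<exists>F. (\<forall>p\<in>P. F p \<subseteq> P \<and> countable (F p)) \<and>
      (\<forall>p\<in>P. \<forall>q\<in>P. leq p q \<longrightarrow> (\<exists>r \<in> F p \<inter> F q. leq p r \<and> leq r q)))"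

definition wFN :: "'a set \<Rightarrow> bool" where
  "wFN K \<longleftrightarrow> weak_Freese_Nation (ctbl_subsets K) (\<subseteq>)"

definition almost_disjoint :: "'a set set \<Rightarrow> bool" where
  "almost_disjoint \<A> \<longleftrightarrow> (\<forall>A\<in>\<A>. \<forall>B\<in>\<A>. A \<noteq> B \<longrightarrow> finite (A \<inter> B))"

definition saturated :: "'a set \<Rightarrow> 'a set set \<Rightarrow> bool" where
  "saturated K \<A> \<longleftrightarrow> (\<forall>X \<in> ctbl_subsets K.
      (\<exists>A\<in>\<A>. A \<subseteq> X) \<or> (\<exists>\<A>'. \<A>' \<subseteq> \<A> \<and> finite \<A>' \<and> finite (X - \<Union>\<A>')))"

definition SAT :: "'a set \<Rightarrow> bool" where
  "SAT K \<longleftrightarrow> (\<exists>\<A>. \<A> \<subseteq> ctbl_subsets K \<and> almost_disjoint \<A> \<and> saturated K \<A>)"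

definition is_base :: "'a topology \<Rightarrow> 'a set set \<Rightarrow> bool" where
  "is_base X \<B> \<longleftrightarrow> openin X = arbitrary union_of (\<lambda>V. V \<in> \<B>)"

definition nt_witness :: "'a topology \<Rightarrow> 'c rel \<Rightarrow> bool" where
  "nt_witness X \<kappa> \<longleftrightarrow> (\<exists>\<B>. is_base X \<B> \<and> (\<forall>B\<in>\<B>. card_of {B'\<in>\<B>. B \<subseteq> B'} <o \<kappa>))"

text \<open>Nt(X) = omega_1: omega_1 is the least cardinal kappa with nt_witness X kappa.
  The cardinals below omega_1 are exactly the countable ones, all representable on nat.\<close>
definition Nt_eq_omega1 :: "'a topology \<Rightarrow> bool" where
  "Nt_eq_omega1 X \<longleftrightarrow> nt_witness X (cardSuc natLeq) \<and>
     (\<forall>\<mu> :: nat rel. Card_order \<mu> \<and> \<mu> <o cardSuc natLeq \<longrightarrow> \<not> nt_witness X \<mu>)"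

definition gdelta_modification :: "'a topology \<Rightarrow> 'a topology" where
  "gdelta_modification X = topology_generated_by {S. gdelta_in X S}"

definition Nt :: "'a set \<Rightarrow> bool" where
  "Nt K \<longleftrightarrow> Nt_eq_omega1
     (gdelta_modification (product_topology (\<lambda>_. discrete_topology (UNIV :: bool set)) K))"

definition omega_homogeneous :: "'a set \<Rightarrow> ('a \<Rightarrow> 'a) set \<Rightarrow> bool" where
  "omega_homogeneous A G \<longleftrightarrow>
     (\<forall>X\<in>ctbl_subsets A. \<forall>Y\<in>ctbl_subsets A. \<exists>g\<in>G. g ` X = Y)"

text \<open>An injective partial function f on A is given by its domain D and values on D.\<close>
definition omega_transitive :: "'a set \<Rightarrow> ('a \<Rightarrow> 'a) set \<Rightarrow> bool" where
  "omega_transitive A G \<longleftrightarrow>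
     (\<forall>D f. inj_on f D \<and> D \<union> f ` D \<in> ctbl_subsets A \<longrightarrow> (\<exists>g\<in>G. \<forall>x\<in>D. g x = f x))"

definition HnT :: "'a set \<Rightarrow> bool" where
  "HnT K \<longleftrightarrow> (\<exists>G. subgroup G (BijGroup K) \<and> omega_homogeneous K G \<and> \<not> omega_transitive K G)"

end

theory Submission
  imports Defs "HOL-Library.Countable_Set_Type" "HOL-Library.Nat_Bijection" "HOL-Library.Infinite_Set"
begin

text \<open>
  Only CH is used. A splendid space has a base of countable clopen sets; countable compactness makes
  them cofinal, and separates them well enough that they have countably many traces on a countable
  set, which gives CLS. Given a well-ordered locally small cofinal family \<open>\<A>\<close>, put into \<open>F Y\<close>, for
  each trace \<open>Z = Y \<inter> A\<close>, the sets preceding \<open>Z\<close> in an enumeration of length \<open>\<omega>\<^sub>1\<close> of the subsets of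
  the first member of \<open>\<A>\<close> covering \<open>Z\<close>; this \<open>F\<close> witnesses wFN.

  Conversely, close each countable set under the wFN-function and under infinite subsets. The
  closures have size at most \<open>\<omega>\<^sub>1\<close>, unions of closures are closed again, and a closed family traces
  on any \<open>X\<close> through countably many of its members below \<open>X\<close>. Listing the closures one
  after the other thus well-orders the countable sets so that at every \<open>X\<close> only countably many
  earlier sets matter. SAT, Nt and HnT are then obtained along this well-order: by diagonalising
  against countably many sets, by keeping the sets not covered by an earlier one, and by
  amalgamating enumerations \<open>X \<rightarrow> \<omega>\<close> that agree up to splitting into finitely many monotone pieces.
  The permutations respecting these enumerations up to such splittings form the group for HnT.
\<close>

section \<open>Countable sets under CH, and the implication from CLS to wFN\<close>

lemma ctbl_subsetsI: "X \<subseteq> S \<Longrightarrow> countable X \<Longrightarrow> infinite X \<Longrightarrow> X \<in> ctbl_subsets S"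
  by (simp add: ctbl_subsets_def)

lemma ctbl_subsetsD:
  assumes "X \<in> ctbl_subsets S"
  shows "X \<subseteq> S" "countable X" "infinite X"
  using assms by (auto simp: ctbl_subsets_def)

lemma ctbl_subsets_mono: "X \<in> ctbl_subsets S \<Longrightarrow> Y \<subseteq> X \<Longrightarrow> infinite Y \<Longrightarrow> Y \<in> ctbl_subsets S"
  by (auto simp: ctbl_subsets_def dest: countable_subset)

section \<open>Well-founded total orders, given as strict relations\<close>

lemma wf_least:
  assumes "wf r" "P x"
  shows "\<exists>m. P m \<and> (\<forall>y. (y, m) \<in> r \<longrightarrow> \<not> P y)"
proof -
  have "\<exists>m\<in>Collect P. \<forall>y. (y, m) \<in> r \<longrightarrow> y \<notin> Collect P"
    using assms(1)[unfolded wf_eq_minimal, rule_format, of x "Collect P"] assms(2) by simp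
  then show ?thesis by simp
qed

text \<open>If transitivity failed, totality would close \<open>x\<close>, \<open>y\<close>,
  \<open>z\<close> into a cycle, and \<open>{x, y, z}\<close> would have no minimal element. So the
  orders below can be specified by well-foundedness and totality alone.\<close>

lemma wf_total_on_trans:
  assumes wf: "wf r" and tot: "\<And>x y. x \<in> S \<Longrightarrow> y \<in> S \<Longrightarrow> x \<noteq> y \<Longrightarrow> (x, y) \<in> r \<or> (y, x) \<in> r"
    and S: "x \<in> S" "y \<in> S" "z \<in> S" and xy: "(x, y) \<in> r" and yz: "(y, z) \<in> r"
  shows "(x, z) \<in> r"
proof (rule ccontr)
  assume n: "(x, z) \<notin> r"
  have "x \<noteq> z" using xy yz wf_asym[OF wf] by metis
  then have zx: "(z, x) \<in> r" using n tot S by metis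
  have "x \<in> {x, y, z}" by simp
  from wf_least[of r "\<lambda>m. m \<in> {x, y, z}", OF wf this]
  obtain m where "m \<in> {x, y, z}" "\<And>w. (w, m) \<in> r \<Longrightarrow> w \<notin> {x, y, z}" by blast
  then show False using xy yz zx by auto
qed

lemma exists_wf_total: "\<exists>r :: 'x rel. wf r \<and> (\<forall>x y. x \<noteq> y \<longrightarrow> (x, y) \<in> r \<or> (y, x) \<in> r)"
proof -
  obtain r :: "'x rel" where r: "Well_order r" "Field r = UNIV"
    using well_ordering[where ?'a = "'x"] by metis
  have "wf (r - Id)" using r by (simp add: well_order_on_def)
  moreover have "\<forall>x y. x \<noteq> y \<longrightarrow> (x, y) \<in> r - Id \<or> (y, x) \<in> r - Id"
    using r by (auto simp: well_order_on_def linear_order_on_def total_on_def)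
  ultimately show ?thesis by blast
qed

text \<open>\<open>S\<close> is injected into the well-order \<open>cardSuc natLeq\<close>, that is
  \<open>\<omega>\<^sub>1\<close>, whose proper initial segments are countable, and the strict order
  is pulled back.\<close>

lemma exists_wf_countable_segments:
  fixes S :: "'x set"
  assumes "card_of S \<le>o cardSuc natLeq"
  shows "\<exists>r. wf r \<and> (\<forall>x\<in>S. \<forall>y\<in>S. x \<noteq> y \<longrightarrow> (x, y) \<in> r \<or> (y, x) \<in> r)
            \<and> (\<forall>y. countable {x\<in>S. (x, y) \<in> r})"
proof -
  define k where "k = cardSuc natLeq"
  have ck: "Card_order k" unfolding k_def by (simp add: cardSuc_Card_order natLeq_Card_order)
  then have wo: "Well_order k" by (simp add: card_order_on_def)
  have "card_of S \<le>o card_of (Field k)"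
    using assms card_of_Field_ordIso[OF ck] unfolding k_def
    using ordIso_symmetric ordLeq_ordIso_trans by blast
  then obtain i where i: "inj_on i S" "i ` S \<subseteq> Field k"
    by (auto simp flip: card_of_ordLeq)
  define r where "r = inv_image (k - Id) i"
  have "wf r" unfolding r_def using wo by (intro wf_inv_image) (simp add: well_order_on_def)
  moreover have "\<forall>x\<in>S. \<forall>y\<in>S. x \<noteq> y \<longrightarrow> (x, y) \<in> r \<or> (y, x) \<in> r"
  proof (intro ballI impI)
    fix x y assume xy: "x \<in> S" "y \<in> S" "x \<noteq> y"
    then have "i x \<noteq> i y" "i x \<in> Field k" "i y \<in> Field k" using i by (auto simp: inj_on_def)
    moreover have "Total k" using wo by (simp add: well_order_on_def linear_order_on_def)
    ultimately show "(x, y) \<in> r \<or> (y, x) \<in> r" by (auto simp: r_def total_on_def)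
  qed
  moreover have "countable {x\<in>S. (x, y) \<in> r}" for y
  \<comment> \<open>The bound is claimed for every \<open>y\<close> of the type. When
    \<open>i y\<close> misses the field of \<open>k\<close>, nothing precedes
    \<open>y\<close>.\<close>
  proof (cases "i y \<in> Field k")
    case True
    have "card_of (underS k (i y)) <o k" by (rule card_of_underS[OF ck True])
    then have "card_of (underS k (i y)) \<le>o natLeq"
      unfolding k_def
      by (simp add: cardSuc_ordLeq_ordLess natLeq_Card_order card_of_Card_order)
    then have c: "countable (underS k (i y))" by (simp add: countable_card_le_natLeq)
    have "i ` {x\<in>S. (x, y) \<in> r} \<subseteq> underS k (i y)"
      by (auto simp: r_def underS_def)
    then have "countable (i ` {x\<in>S. (x, y) \<in> r})" using c countable_subset by blast
    then show ?thesis
      by (rule countable_image_inj_on) (use i in \<open>auto simp: inj_on_def\<close>)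
  next
    case False
    then have "{x\<in>S. (x, y) \<in> r} = {}" by (auto simp: r_def Field_def)
    then show ?thesis by (metis countable_empty)
  qed
  ultimately show ?thesis by blast
qed

section \<open>The continuum hypothesis for countable subsets of \<open>K\<close>\<close>

definition CH_on :: "'a set \<Rightarrow> bool" where
  "CH_on K \<longleftrightarrow> (\<forall>X\<subseteq>K. countable X \<longrightarrow> card_of (Pow X) \<le>o cardSuc natLeq)"

lemma GCH_on_imp_CH_on:
  assumes "GCH_on (UNIV :: 'a set)"
  shows "CH_on (K :: 'a set)"
  unfolding CH_on_def
proof (intro allI impI)
  fix X :: "'a set" assume "X \<subseteq> K" and c: "countable X"
  show "card_of (Pow X) \<le>o cardSuc natLeq"
  proof (cases "finite X")
    case True
    then have "countable (Pow X)" by (simp add: countable_finite)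
    then have "card_of (Pow X) \<le>o natLeq" by (simp add: countable_card_le_natLeq)
    then show ?thesis
      using cardSuc_ordLeq[OF natLeq_Card_order] ordLeq_transitive by blast
  next
    case False
    then have "card_of (Pow X) =o cardSuc (card_of X)" using assms by (auto simp: GCH_on_def)
    moreover have "cardSuc (card_of X) \<le>o cardSuc natLeq"
      using c by (simp add: cardSuc_mono_ordLeq card_of_Card_order natLeq_Card_order
          countable_card_le_natLeq)
    ultimately show ?thesis using ordIso_ordLeq_trans by blast
  qed
qed

lemma card_of_ctbl_subsets_le:
  assumes "CH_on K" "X \<in> ctbl_subsets K"
  shows "card_of (ctbl_subsets X) \<le>o cardSuc natLeq"
proof -
  have "card_of (ctbl_subsets X) \<le>o card_of (Pow X)"
    by (rule card_of_mono1) (auto simp: ctbl_subsets_def)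
  moreover have "card_of (Pow X) \<le>o cardSuc natLeq"
    using assms by (auto simp: CH_on_def ctbl_subsets_def)
  ultimately show ?thesis by (rule ordLeq_transitive)
qed

text \<open>If \<open>A\<close> is the first member of \<open>\<A>\<close> covering
  \<open>X\<close>, and \<open>X \<subseteq> Z \<subseteq> A\<close>, then \<open>A\<close> is also
  the first member covering \<open>Z\<close>. With \<open>Z = Y \<inter> A\<close>, both sets are
  thus compared in one enumeration of \<open>ctbl_subsets A\<close>, and the earlier of the two
  interpolates between \<open>X\<close> and \<open>Y\<close>.\<close>

lemma CLS_imp_wFN:
  fixes K :: "'a set"
  assumes CH: "CH_on K" and CLS: "CLS K"
  shows "wFN K"
proof -
  obtain \<A> where "\<A> \<subseteq> ctbl_subsets K \<and> (\<forall>X \<in> ctbl_subsets K. \<exists>A\<in>\<A>. X \<subseteq> A) \<and> locally_small K \<A>"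
    using CLS unfolding CLS_def ..
  then have \<A>: "\<A> \<subseteq> ctbl_subsets K"
    and cof: "\<And>X. X \<in> ctbl_subsets K \<Longrightarrow> \<exists>A\<in>\<A>. X \<subseteq> A"
    and small: "\<And>X. X \<in> ctbl_subsets K \<Longrightarrow> countable ((\<lambda>A. X \<inter> A) ` \<A>)"
    by (simp_all add: locally_small_def)
  obtain r :: "'a set rel" where wf: "wf r" and tot: "\<And>x y. x \<noteq> y \<Longrightarrow> (x, y) \<in> r \<or> (y, x) \<in> r"
    using exists_wf_total[where 'x = "'a set"] by metis
  define least where "least Z A \<longleftrightarrow> A \<in> \<A> \<and> Z \<subseteq> A \<and> (\<forall>B. (B, A) \<in> r \<longrightarrow> B \<in> \<A> \<longrightarrow> \<not> Z \<subseteq> B)"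
    for Z A
  define env where "env Z = (SOME A. least Z A)" for Z
  have least_unique: "A = B" if "least Z A" "least Z B" for Z A B
    using that tot[of A B] by (metis least_def)
  have least_env: "least Z (env Z)" if Z: "Z \<in> ctbl_subsets K" for Z
  proof -
    obtain A0 where "A0 \<in> \<A> \<and> Z \<subseteq> A0" using cof[OF Z] by blast
    from wf_least[of r "\<lambda>A. A \<in> \<A> \<and> Z \<subseteq> A", OF wf this]
    obtain A where "A \<in> \<A> \<and> Z \<subseteq> A" "\<And>B. (B, A) \<in> r \<Longrightarrow> \<not> (B \<in> \<A> \<and> Z \<subseteq> B)"
      by blast
    then have "least Z A" unfolding least_def by blast
    then show ?thesis unfolding env_def by (rule someI)
  qed
  \<comment> \<open>CH gives each \<open>ctbl_subsets A\<close> an enumeration \<open>s A\<close>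
    with countable initial segments.\<close>
  have "\<forall>A\<in>\<A>. \<exists>s. wf s \<and> (\<forall>x\<in>ctbl_subsets A. \<forall>y\<in>ctbl_subsets A. x \<noteq> y \<longrightarrow> (x, y) \<in> s \<or> (y, x) \<in> s)
            \<and> (\<forall>y. countable {x\<in>ctbl_subsets A. (x, y) \<in> s})"
    using \<A> card_of_ctbl_subsets_le[OF CH] by (blast intro: exists_wf_countable_segments)
  from bchoice[OF this] obtain s where "\<forall>A\<in>\<A>. wf (s A) \<and>
      (\<forall>x\<in>ctbl_subsets A. \<forall>y\<in>ctbl_subsets A. x \<noteq> y \<longrightarrow> (x, y) \<in> s A \<or> (y, x) \<in> s A) \<and>
      (\<forall>y. countable {x\<in>ctbl_subsets A. (x, y) \<in> s A})" ..
  then have s_tot: "\<And>A x y. A \<in> \<A> \<Longrightarrow> x \<in> ctbl_subsets A \<Longrightarrow> y \<in> ctbl_subsets A \<Longrightarrow> x \<noteq> y \<Longrightarrow>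
               (x, y) \<in> s A \<or> (y, x) \<in> s A"
    and s_ctbl: "\<And>A y. A \<in> \<A> \<Longrightarrow> countable {x\<in>ctbl_subsets A. (x, y) \<in> s A}"
    by simp_all
  define W where "W Z = insert Z {V\<in>ctbl_subsets (env Z). (V, Z) \<in> s (env Z)}" for Z
  \<comment> \<open>Local smallness leaves countably many traces \<open>Z\<close> on
    \<open>Y\<close>, so \<open>F Y\<close> is a countable union of the countable sets
    \<open>W Z\<close>. Finite traces are dropped because they lie outside the poset.\<close>
  define F where "F Y = (\<Union>Z \<in> {Z. infinite Z \<and> Z \<in> (\<lambda>A. Y \<inter> A) ` \<A>}. W Z)" for Y
  have W: "W Z \<subseteq> ctbl_subsets K" "countable (W Z)" if Z: "Z \<in> ctbl_subsets K" for Z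
  proof -
    have h: "env Z \<in> \<A>" using least_env[OF Z] by (simp add: least_def)
    then have "ctbl_subsets (env Z) \<subseteq> ctbl_subsets K"
      using \<A> by (auto simp: ctbl_subsets_def)
    then show "W Z \<subseteq> ctbl_subsets K" using Z by (auto simp: W_def)
    show "countable (W Z)" unfolding W_def using s_ctbl[OF h] by simp
  qed
  have tr: "Z \<in> ctbl_subsets K" if "Y \<in> ctbl_subsets K" "infinite Z" "Z \<in> (\<lambda>A. Y \<inter> A) ` \<A>" for Y Z
    using that by (auto intro: ctbl_subsets_mono)
  have F: "F Y \<subseteq> ctbl_subsets K \<and> countable (F Y)" if Y: "Y \<in> ctbl_subsets K" for Y
  proof
    show "F Y \<subseteq> ctbl_subsets K" unfolding F_def using tr[OF Y] W by blast
    have "countable {Z. infinite Z \<and> Z \<in> (\<lambda>A. Y \<inter> A) ` \<A>}"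
      by (rule countable_subset[OF _ small[OF Y]]) blast
    then show "countable (F Y)" unfolding F_def using tr[OF Y] W by (intro countable_UN) auto
  qed
  have "\<exists>R\<in>F X \<inter> F Y. X \<subseteq> R \<and> R \<subseteq> Y"
    if X: "X \<in> ctbl_subsets K" and Y: "Y \<in> ctbl_subsets K" and "X \<subseteq> Y" for X Y
  proof -
    define A where "A = env X"
    have lX: "least X A" using least_env[OF X] by (simp add: A_def)
    then have A: "A \<in> \<A>" "X \<subseteq> A" by (auto simp: least_def)
    define Z where "Z = Y \<inter> A"
    have XZ: "X \<subseteq> Z" using A \<open>X \<subseteq> Y\<close> by (auto simp: Z_def)
    have infZ: "infinite Z" using XZ X by (auto simp: ctbl_subsets_def dest: finite_subset)
    have ZK: "Z \<in> ctbl_subsets K" using Y infZ by (auto simp: Z_def intro: ctbl_subsets_mono)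
    \<comment> \<open>A member preceding \<open>A\<close> and covering \<open>Z\<close> would also
      cover \<open>X\<close>.\<close>
    have "least Z A" using lX XZ unfolding least_def Z_def by blast
    then have hZ: "env Z = A" by (rule least_unique[OF least_env[OF ZK]])
    have WX: "W X \<subseteq> F X"
      unfolding F_def
    proof (rule UN_upper)
      \<comment> \<open>\<open>X\<close> is itself a trace on \<open>X\<close>, namely the trace of
        \<open>A\<close>.\<close>
      have "X = X \<inter> A" using A by blast
      then show "X \<in> {Z. infinite Z \<and> Z \<in> (\<lambda>A. X \<inter> A) ` \<A>}"
        using A ctbl_subsetsD(3)[OF X] by blast
    qed
    have WZ: "W Z \<subseteq> F Y"
      unfolding F_def using A infZ by (intro UN_upper) (auto simp: Z_def)
    have sub: "X \<in> ctbl_subsets A" "Z \<in> ctbl_subsets A"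
      using X ZK A by (auto simp: ctbl_subsets_def Z_def)
    show ?thesis
    proof (cases "X = Z \<or> (X, Z) \<in> s A")
      case True
      then have "X \<in> W Z" unfolding W_def hZ using sub(1) by blast
      moreover have "X \<in> W X" by (simp add: W_def)
      ultimately have "X \<in> F X \<inter> F Y" using WX WZ by blast
      then show ?thesis using \<open>X \<subseteq> Y\<close> by blast
    next
      case False
      then have "(Z, X) \<in> s A" using s_tot A sub by blast
      then have "Z \<in> W X" "Z \<in> W Z" using sub by (simp_all add: W_def flip: A_def)
      then have "Z \<in> F X \<inter> F Y" using WX WZ by blast
      moreover have "Z \<subseteq> Y" by (simp add: Z_def)
      ultimately show ?thesis using XZ by blast
    qed
  qed
  with F show ?thesis unfolding wFN_def weak_Freese_Nation_def by (intro exI[of _ F]) simp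
qed

section \<open>Tracing orders and saturated families\<close>

text \<open>At most \<open>\<omega>\<^sub>1\<close> many points are reached in exactly
  \<open>n\<close> steps, by induction on \<open>n\<close>, and \<open>R\<^sup>*\<close> is the
  union over countably many \<open>n\<close>. This will bound the closure of one countable set under
  the weak Freese-Nation function and infinite subsets.\<close>

lemma card_of_rtrancl_image_le:
  assumes "\<And>x. card_of (R `` {x}) \<le>o cardSuc natLeq"
  shows "card_of (R\<^sup>* `` {x}) \<le>o cardSuc natLeq"
proof -
  define k where "k = cardSuc natLeq"
  have ck: "Card_order k" unfolding k_def by (simp add: cardSuc_Card_order natLeq_Card_order)
  have inf: "infinite (Field k)"
    using Cinfinite_cardSuc[OF natLeq_Cinfinite] by (simp add: cinfinite_def k_def)
  have nk: "natLeq \<le>o k" unfolding k_def by (rule cardSuc_ordLeq[OF natLeq_Card_order])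
  have step: "card_of ((R ^^ n) `` {x}) \<le>o k" for n
  proof (induction n)
    case 0
    have "card_of {x} \<le>o natLeq" by (simp flip: countable_card_le_natLeq)
    then show ?case using nk ordLeq_transitive by (simp add: Image_def) blast
  next
    case (Suc n)
    have "(R ^^ Suc n) `` {x} = (\<Union>y\<in>(R ^^ n) `` {x}. R `` {y})" by auto
    then show ?case
      using card_of_UNION_ordLeq_infinite_Field[OF inf ck Suc.IH, of "\<lambda>y. R `` {y}"] assms
      by (simp add: k_def)
  qed
  have "R\<^sup>* `` {x} = (\<Union>n\<in>UNIV. (R ^^ n) `` {x})" by (auto simp: rtrancl_power)
  moreover have "card_of (UNIV :: nat set) \<le>o k"
    using nk card_of_nat ordIso_ordLeq_trans by blast
  ultimately show ?thesis
    using card_of_UNION_ordLeq_infinite_Field[OF inf ck, of UNIV "\<lambda>n. (R ^^ n) `` {x}"] step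
    by (simp add: k_def)
qed

text \<open>All that the constructions need from wFN: at stage \<open>X\<close> the countably many earlier sets in \<open>\<Z>\<close>
  control how every earlier set meets \<open>X\<close>.\<close>
definition traceable :: "'a set \<Rightarrow> 'a set rel \<Rightarrow> bool" where
  "traceable K r \<longleftrightarrow> wf r \<and>
     (\<forall>X\<in>ctbl_subsets K. \<forall>Y\<in>ctbl_subsets K. X \<noteq> Y \<longrightarrow> (X, Y) \<in> r \<or> (Y, X) \<in> r) \<and>
     (\<forall>X\<in>ctbl_subsets K. \<exists>\<Z>. countable \<Z> \<and> (\<forall>Z\<in>\<Z>. Z \<in> ctbl_subsets K \<and> (Z, X) \<in> r) \<and>
        (\<forall>Y\<in>ctbl_subsets K. (Y, X) \<in> r \<and> infinite (Y \<inter> X) \<longrightarrow>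
           Y \<in> \<Z> \<or> (\<exists>Z\<in>\<Z>. Y \<inter> X \<subseteq> Z \<and> Z \<subseteq> X)))"

text \<open>The order compares levels first, and inside a level it has countable initial segments.
  An earlier \<open>Y\<close> of the same level as \<open>X\<close> is therefore one of countably
  many. For \<open>Y\<close> of a lower level, an interpolant between \<open>Y \<inter> X\<close>
  and \<open>X\<close> lies in the countable set \<open>F X\<close> and in the closure containing
  \<open>Y\<close>, hence again in a lower level.\<close>

lemma wFN_imp_traceable:
  fixes K :: "'a set"
  assumes CH: "CH_on K" and wFN: "wFN K"
  shows "\<exists>r. traceable K r"
proof -
  let ?P = "ctbl_subsets K"
  obtain F where "(\<forall>p\<in>?P. F p \<subseteq> ?P \<and> countable (F p)) \<and>
      (\<forall>p\<in>?P. \<forall>q\<in>?P. p \<subseteq> q \<longrightarrow> (\<exists>r \<in> F p \<inter> F q. p \<subseteq> r \<and> r \<subseteq> q))"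
    using wFN unfolding wFN_def weak_Freese_Nation_def ..
  then have F: "\<And>p. p \<in> ?P \<Longrightarrow> F p \<subseteq> ?P" "\<And>p. p \<in> ?P \<Longrightarrow> countable (F p)"
    and FN: "\<And>p q. p \<in> ?P \<Longrightarrow> q \<in> ?P \<Longrightarrow> p \<subseteq> q \<Longrightarrow> \<exists>r\<in>F p \<inter> F q. p \<subseteq> r \<and> r \<subseteq> q"
    by simp_all
  \<comment> \<open>One step passes from \<open>X\<close> to a value of \<open>F\<close> or to an
    infinite subset. Together these lead from \<open>Y\<close> to \<open>Y \<inter> X\<close> and on
    to an interpolant.\<close>
  define R where "R = {(X, Y). X \<in> ?P \<and> (Y \<in> F X \<or> Y \<in> ctbl_subsets X)}"
  define k where "k = cardSuc natLeq"
  have ck: "Card_order k" unfolding k_def by (simp add: cardSuc_Card_order natLeq_Card_order)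
  have inf: "infinite (Field k)"
    using Cinfinite_cardSuc[OF natLeq_Cinfinite] by (simp add: cinfinite_def k_def)
  have nk: "natLeq \<le>o k" unfolding k_def by (rule cardSuc_ordLeq[OF natLeq_Card_order])
  have "card_of (R `` {X}) \<le>o cardSuc natLeq" for X
  proof (cases "X \<in> ?P")
    case True
    have "R `` {X} = F X \<union> ctbl_subsets X" using True by (auto simp: R_def)
    moreover have "card_of (F X) \<le>o k"
      using F(2)[OF True] nk ordLeq_transitive by (auto simp: countable_card_le_natLeq)
    moreover have "card_of (ctbl_subsets X) \<le>o k"
      using card_of_ctbl_subsets_le[OF CH True] by (simp add: k_def)
    ultimately show ?thesis
      using card_of_Un_ordLeq_infinite_Field[OF inf] ck by (simp add: k_def)
  next
    case False
    then have "R `` {X} = {}" by (auto simp: R_def)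
    then show ?thesis
      using card_of_empty1[of k] ck by (metis k_def card_order_on_def)
  qed
  note card_R = card_of_rtrancl_image_le[OF this]
  define C where "C p = R\<^sup>* `` {p}" for p
  obtain u :: "'a set rel" where wfu: "wf u" and totu: "\<And>x y. x \<noteq> y \<Longrightarrow> (x, y) \<in> u \<or> (y, x) \<in> u"
    using exists_wf_total[where 'x = "'a set"] by metis
  \<comment> \<open>The level of \<open>X\<close> is the \<open>u\<close>-least \<open>p\<close>
    whose closure contains \<open>X\<close>; there is one, since \<open>X\<close> lies in its own
    closure.\<close>
  have "\<exists>p. X \<in> C p \<and> (\<forall>q. (q, p) \<in> u \<longrightarrow> X \<notin> C q)" for X
  proof -
    have "X \<in> {p. X \<in> C p}" by (auto simp: C_def)
    then obtain p where "p \<in> {p. X \<in> C p}" "\<And>q. (q, p) \<in> u \<Longrightarrow> q \<notin> {p. X \<in> C p}"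
      using wfE_min[OF wfu] by metis
    then show ?thesis by blast
  qed
  then obtain lev where lev: "\<And>X. X \<in> C (lev X)" and lev_min: "\<And>X q. (q, lev X) \<in> u \<Longrightarrow> X \<notin> C q"
    by metis
  have "\<forall>p. \<exists>t. wf t \<and> (\<forall>x\<in>C p. \<forall>y\<in>C p. x \<noteq> y \<longrightarrow> (x, y) \<in> t \<or> (y, x) \<in> t)
            \<and> (\<forall>y. countable {x\<in>C p. (x, y) \<in> t})"
    using exists_wf_countable_segments[OF card_R] unfolding C_def by blast
  from choice[OF this] obtain t where "\<forall>p. wf (t p) \<and>
      (\<forall>x\<in>C p. \<forall>y\<in>C p. x \<noteq> y \<longrightarrow> (x, y) \<in> t p \<or> (y, x) \<in> t p) \<and>
      (\<forall>y. countable {x\<in>C p. (x, y) \<in> t p})" ..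
  then have wft: "\<And>p. wf (t p)"
    and tott: "\<And>p x y. x \<in> C p \<Longrightarrow> y \<in> C p \<Longrightarrow> x \<noteq> y \<Longrightarrow> (x, y) \<in> t p \<or> (y, x) \<in> t p"
    and ctbt: "\<And>p y. countable {x\<in>C p. (x, y) \<in> t p}"
    by simp_all
  \<comment> \<open>The sets of level below \<open>p\<close> form a union of closures, hence are closed under \<open>R\<close>.\<close>
  define r where "r = {(X, Y). (lev X, lev Y) \<in> u \<or> (lev X = lev Y \<and> (X, Y) \<in> t (lev X))}"
  have transu: "(p, s) \<in> u" if "(p, q) \<in> u" "(q, s) \<in> u" for p q s
    by (rule wf_total_on_trans[OF wfu, of UNIV p q s]) (use that totu in auto)
  have wfr: "wf r"
  proof -
    show ?thesis
    proof (rule wfI_min)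
      fix X Q assume "X \<in> (Q :: 'a set set)"
      then have "lev X \<in> lev ` Q" by blast
      from wf_least[of u "\<lambda>p. p \<in> lev ` Q", OF wfu this]
      obtain p where p: "p \<in> lev ` Q" "\<And>q. (q, p) \<in> u \<Longrightarrow> q \<notin> lev ` Q" by blast
      then obtain Y where "Y \<in> Q \<and> lev Y = p" by blast
      from wf_least[of "t p" "\<lambda>Y. Y \<in> Q \<and> lev Y = p", OF wft this]
      obtain Z where Z: "Z \<in> Q \<and> lev Z = p" "\<And>V. (V, Z) \<in> t p \<Longrightarrow> \<not> (V \<in> Q \<and> lev V = p)"
        by blast
      have "V \<notin> Q" if "(V, Z) \<in> r" for V
        using that Z p(2)[of "lev V"] by (auto simp: r_def)
      then show "\<exists>z\<in>Q. \<forall>y. (y, z) \<in> r \<longrightarrow> y \<notin> Q" using Z by blast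
    qed
  qed
  have totr: "(X, Y) \<in> r \<or> (Y, X) \<in> r" if "X \<noteq> Y" for X Y
    using that totu[of "lev X" "lev Y"] tott[of X "lev X" Y] lev unfolding r_def by force
  have Zr: "\<exists>\<Z>. countable \<Z> \<and> (\<forall>Z\<in>\<Z>. Z \<in> ?P \<and> (Z, X) \<in> r) \<and>
        (\<forall>Y\<in>?P. (Y, X) \<in> r \<and> infinite (Y \<inter> X) \<longrightarrow>
           Y \<in> \<Z> \<or> (\<exists>Z\<in>\<Z>. Y \<inter> X \<subseteq> Z \<and> Z \<subseteq> X))" if X: "X \<in> ?P" for X
  proof (intro exI conjI)
    \<comment> \<open>The controlling sets have two sources: values of \<open>F X\<close> in lower
      levels, and the predecessors of \<open>X\<close> within its own level.\<close>
    let ?Z1 = "{Z\<in>F X. (lev Z, lev X) \<in> u}"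
    let ?Z2 = "{Z\<in>?P. lev Z = lev X \<and> (Z, X) \<in> t (lev X)}"
    have "countable {Z\<in>C (lev X). (Z, X) \<in> t (lev X)}" by (rule ctbt)
    moreover have "?Z2 \<subseteq> {Z\<in>C (lev X). (Z, X) \<in> t (lev X)}"
    proof
      fix Z assume "Z \<in> ?Z2"
      then show "Z \<in> {Z\<in>C (lev X). (Z, X) \<in> t (lev X)}" using lev[of Z] by auto
    qed
    ultimately have "countable ?Z2" by (rule countable_subset[rotated])
    moreover have "countable ?Z1" using F(2)[OF X] by (rule countable_subset[rotated]) blast
    ultimately show "countable (?Z1 \<union> ?Z2)" by simp
    show "\<forall>Z\<in>?Z1 \<union> ?Z2. Z \<in> ?P \<and> (Z, X) \<in> r"
      using F(1)[OF X] by (auto simp: r_def)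
    show "\<forall>Y\<in>?P. (Y, X) \<in> r \<and> infinite (Y \<inter> X) \<longrightarrow>
           Y \<in> ?Z1 \<union> ?Z2 \<or> (\<exists>Z\<in>?Z1 \<union> ?Z2. Y \<inter> X \<subseteq> Z \<and> Z \<subseteq> X)"
    proof (intro ballI impI, elim conjE)
      fix Y assume Y: "Y \<in> ?P" and YX: "(Y, X) \<in> r" and i: "infinite (Y \<inter> X)"
      show "Y \<in> ?Z1 \<union> ?Z2 \<or> (\<exists>Z\<in>?Z1 \<union> ?Z2. Y \<inter> X \<subseteq> Z \<and> Z \<subseteq> X)"
      proof (cases "(lev Y, lev X) \<in> u")
        case True
        have T: "Y \<inter> X \<in> ?P" by (rule ctbl_subsets_mono[OF X]) (use i in auto)
        obtain Z where Z: "Z \<in> F (Y \<inter> X)" "Z \<in> F X" "Y \<inter> X \<subseteq> Z" "Z \<subseteq> X"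
          using FN[OF T X] by blast
        have "(Y, Y \<inter> X) \<in> R" using Y T by (auto simp: R_def ctbl_subsets_def)
        moreover have "(Y \<inter> X, Z) \<in> R" using T Z by (auto simp: R_def)
        ultimately have "Z \<in> C (lev Y)"
          using lev[of Y] unfolding C_def by (auto intro: rtrancl_into_rtrancl)
        \<comment> \<open>\<open>Z\<close> lies in the closure \<open>C (lev Y)\<close>, so its own
          level, being least, is not above \<open>lev Y\<close>.\<close>
        then have "(lev Z, lev Y) \<in> u \<or> lev Z = lev Y" using lev_min totu by blast
        then have "(lev Z, lev X) \<in> u" using True transu by metis
        then show ?thesis using Z by blast
      next
        case False
        then show ?thesis using YX Y by (auto simp: r_def)
      qed
    qed
  qed
  have "traceable K r"
    unfolding traceable_def
  proof (intro conjI ballI impI)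
    show "(X, Y) \<in> r \<or> (Y, X) \<in> r" if "X \<noteq> Y" for X Y using that by (rule totr)
  qed (fact wfr, fact Zr)
  then show ?thesis by blast
qed

lemma traceableD:
  assumes "traceable K r"
  shows "wf r"
    and "\<And>X Y. X \<in> ctbl_subsets K \<Longrightarrow> Y \<in> ctbl_subsets K \<Longrightarrow> X \<noteq> Y \<Longrightarrow> (X, Y) \<in> r \<or> (Y, X) \<in> r"
    and "\<And>X. X \<in> ctbl_subsets K \<Longrightarrow>
      \<exists>\<Z>. countable \<Z> \<and> (\<forall>Z\<in>\<Z>. Z \<in> ctbl_subsets K \<and> (Z, X) \<in> r) \<and>
        (\<forall>Y\<in>ctbl_subsets K. (Y, X) \<in> r \<and> infinite (Y \<inter> X) \<longrightarrow>
           Y \<in> \<Z> \<or> (\<exists>Z\<in>\<Z>. Y \<inter> X \<subseteq> Z \<and> Z \<subseteq> X))"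
  using assms by (simp_all add: traceable_def)

lemma traceable_trans:
  assumes "traceable K r" "X \<in> ctbl_subsets K" "Y \<in> ctbl_subsets K" "Z \<in> ctbl_subsets K"
    "(X, Y) \<in> r" "(Y, Z) \<in> r"
  shows "(X, Z) \<in> r"
  by (rule wf_total_on_trans[OF traceableD(1)[OF assms(1)], of "ctbl_subsets K" X Y Z])
     (use assms traceableD(2)[OF assms(1)] in auto)

text \<open>A diagonal argument: the point \<open>b n\<close> is taken outside the first
  \<open>n + 1\<close> sets of an enumeration, which is possible because no finite subfamily almost
  covers \<open>X\<close>. Each \<open>C\<close> then contains only points chosen before its
  index.\<close>

lemma almost_disjoint_subset:
  fixes \<C> :: "'a set set"
  assumes "countable X" "countable \<C>"
    and unc: "\<And>\<F>. \<F> \<subseteq> \<C> \<Longrightarrow> finite \<F> \<Longrightarrow> infinite (X - \<Union>\<F>)"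
  shows "\<exists>B\<subseteq>X. infinite B \<and> (\<forall>C\<in>\<C>. finite (B \<inter> C))"
proof -
  obtain e :: "'a \<Rightarrow> nat" where e: "inj_on e X" using assms(1) by (auto simp: countable_def)
  \<comment> \<open>\<open>{}\<close> is added so that the enumeration works even for an empty
    family; it affects no union.\<close>
  define c where "c = from_nat_into (insert {} \<C>)"
  have range_c: "range c = insert {} \<C>"
    unfolding c_def by (rule range_from_nat_into) (use assms(2) in auto)
  have inf: "infinite (X - \<Union>(c ` {..n}))" for n
  proof -
    have "c ` {..n} - {{}} \<subseteq> \<C>" using range_c by auto
    then have "infinite (X - \<Union>(c ` {..n} - {{}}))" by (intro unc) auto
    moreover have "\<Union>(c ` {..n} - {{}}) = \<Union>(c ` {..n})" by auto
    ultimately show ?thesis by simp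
  qed
  \<comment> \<open>The demand \<open>n \<le> e x\<close> makes \<open>e\<close> unbounded on the
    chosen points, so infinitely many distinct points are chosen.\<close>
  have "\<exists>x. x \<in> X - \<Union>(c ` {..n}) \<and> n \<le> e x" for n
  proof (rule ccontr)
    assume "\<nexists>x. x \<in> X - \<Union>(c ` {..n}) \<and> n \<le> e x"
    then have "e ` (X - \<Union>(c ` {..n})) \<subseteq> {..n}" by force
    then have "finite (e ` (X - \<Union>(c ` {..n})))" using finite_subset by blast
    then have "finite (X - \<Union>(c ` {..n}))"
      by (rule finite_imageD) (use e in \<open>auto simp: inj_on_def\<close>)
    then show False using inf by blast
  qed
  then obtain b where b: "\<And>n. b n \<in> X - \<Union>(c ` {..n})" "\<And>n. n \<le> e (b n)" by metis
  have "infinite (range b)"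
  proof
    assume "finite (range b)"
    then have "finite (e ` range b)" by simp
    then obtain N where N: "\<forall>k\<in>e ` range b. k \<le> N"
      unfolding finite_nat_set_iff_bounded_le ..
    moreover have "e (b (Suc N)) \<in> e ` range b" by (intro imageI rangeI)
    ultimately have "e (b (Suc N)) \<le> N" by (rule bspec)
    then show False using b(2)[of "Suc N"] by simp
  qed
  moreover have "finite (range b \<inter> C)" if "C \<in> \<C>" for C
  proof -
    have "C \<in> range c" using that by (simp add: range_c)
    then obtain i where i: "C = c i" by (rule rangeE)
    have "range b \<inter> C \<subseteq> b ` {..<i}"
    proof
      fix x assume "x \<in> range b \<inter> C"
      then obtain n where "x = b n" "b n \<in> c i" using i by blast
      moreover have "\<not> i \<le> n" using b(1)[of n] \<open>b n \<in> c i\<close> by auto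
      ultimately show "x \<in> b ` {..<i}" by auto
    qed
    then show ?thesis using finite_subset by blast
  qed
  moreover have "range b \<subseteq> X" using b(1) by auto
  ultimately show ?thesis by metis
qed

text \<open>Saturation at the single set \<open>X\<close>, stated for a partial family so that it
  can be tested during the recursion.\<close>

definition hit_by :: "'a set set \<Rightarrow> 'a set \<Rightarrow> bool" where
  "hit_by \<D> X \<longleftrightarrow> (\<exists>A\<in>\<D>. A \<subseteq> X) \<or> (\<exists>\<F>. \<F> \<subseteq> \<D> \<and> finite \<F> \<and> finite (X - \<Union>\<F>))"

lemma hit_by_mono: "hit_by \<D> X \<Longrightarrow> \<D> \<subseteq> \<E> \<Longrightarrow> hit_by \<E> X"
  unfolding hit_by_def by (meson subset_iff)

text \<open>Stages run along \<open>r\<close>. A set \<open>X\<close> not yet hit receives one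
  infinite subset almost disjoint from all earlier members. It suffices to avoid countably many of
  these: any other member with infinite trace on \<open>X\<close> would have it inside some
  controlling \<open>Z \<subseteq> X\<close>, yet \<open>Z\<close> is almost covered by finitely
  many avoided members, from which that member is almost disjoint.\<close>

lemma traceable_imp_SAT:
  fixes K :: "'a set"
  assumes tr: "traceable K r"
  shows "SAT K"
proof -
  let ?P = "ctbl_subsets K"
  define below where "below f X = (\<Union>Y\<in>{Y\<in>?P. (Y, X) \<in> r}. f Y)"
    for f :: "'a set \<Rightarrow> 'a set set" and X
  \<comment> \<open>Stages outside \<open>ctbl_subsets K\<close> are unconstrained. Every other
    stage contributes at most one set, so countably many such stages contribute countably many
    sets.\<close>
  define step where "step f X S \<longleftrightarrow> (X \<in> ?P \<longrightarrow>
      (hit_by (below f X) X \<and> S = {}) \<or>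
      (\<exists>B. S = {B} \<and> B \<subseteq> X \<and> infinite B \<and> (\<forall>A\<in>below f X. finite (B \<inter> A))))" for f X S
  have belowI: "A \<in> below f X" if "A \<in> f Y" "Y \<in> ?P" "(Y, X) \<in> r" for A f Y X
    using that by (auto simp: below_def)
  have belowE: "\<exists>Y. A \<in> f Y \<and> Y \<in> ?P \<and> (Y, X) \<in> r" if "A \<in> below f X" for A f X
    using that by (auto simp: below_def)
  have sub: "A \<subseteq> Y" "infinite A" if "A \<in> f Y" "Y \<in> ?P" "step f Y (f Y)" for A f Y
    using that by (auto simp: step_def)
  have hit: "hit_by (below f Y \<union> f Y) Y" if "Y \<in> ?P" "step f Y (f Y)" for f Y
    using that by (auto simp: step_def hit_by_def)
  have ad1: "finite (A \<inter> D)"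
    if "A \<in> f Y1" "D \<in> f Y2" "Y1 \<in> ?P" "Y2 \<in> ?P" "step f Y2 (f Y2)" "(Y1, Y2) \<in> r" for A D f Y1 Y2
  proof -
    have "A \<in> below f Y2" using that by (intro belowI)
    then show ?thesis using that by (auto simp: step_def Int_commute)
  qed
  have ad: "finite (A \<inter> D)"
    if "A \<in> f Y1" "D \<in> f Y2" "A \<noteq> D" "Y1 \<in> ?P" "Y2 \<in> ?P" "step f Y1 (f Y1)" "step f Y2 (f Y2)"
    for A D f Y1 Y2
  proof (cases "Y1 = Y2")
    case True
    then show ?thesis using that by (auto simp: step_def)
  next
    case False
    have "(Y1, Y2) \<in> r \<or> (Y2, Y1) \<in> r" by (rule traceableD(2)[OF tr that(4,5) False])
    then consider "(Y1, Y2) \<in> r" | "(Y2, Y1) \<in> r" by blast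
    then show ?thesis
    proof cases
      case 1 then show ?thesis using ad1 that by metis
    next
      case 2 then show ?thesis using ad1 that by (metis Int_commute)
    qed
  qed
  have "\<exists>f. \<forall>X. step f X (f X)"
  proof (rule dependent_wf_choice[OF traceableD(1)[OF tr]])
    fix f g :: "'a set \<Rightarrow> 'a set set" and X S
    assume "\<And>Z. (Z, X) \<in> r \<Longrightarrow> f Z = g Z"
    then have "below f X = below g X" by (auto simp: below_def)
    then show "step f X S = step g X S" by (simp add: step_def)
  next
    fix X f assume IH: "\<And>Y. (Y, X) \<in> r \<Longrightarrow> step f Y (f Y)"
    show "\<exists>S. step f X S"
    proof (cases "X \<in> ?P \<and> \<not> hit_by (below f X) X")
      case False
      then show ?thesis by (auto simp: step_def)
    next
      case True
      then have X: "X \<in> ?P" and nhit: "\<not> hit_by (below f X) X" by auto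
      obtain \<Z> where c\<Z>: "countable \<Z>" and \<Z>: "\<And>Z. Z \<in> \<Z> \<Longrightarrow> Z \<in> ?P \<and> (Z, X) \<in> r"
        and trace: "\<And>Y. Y \<in> ?P \<Longrightarrow> (Y, X) \<in> r \<Longrightarrow> infinite (Y \<inter> X) \<Longrightarrow>
           Y \<in> \<Z> \<or> (\<exists>Z\<in>\<Z>. Y \<inter> X \<subseteq> Z \<and> Z \<subseteq> X)"
        using traceableD(3)[OF tr X] by metis
      \<comment> \<open>\<open>Z\<close> precedes \<open>X\<close>, so it has been hit. As
        \<open>X\<close> contains \<open>Z\<close> and is not hit, no earlier member lies inside
        \<open>Z\<close>; hence finitely many earlier members almost cover \<open>Z\<close>.\<close>
      have "\<exists>\<F>. \<F> \<subseteq> below f X \<and> finite \<F> \<and> finite (Z - \<Union>\<F>)" if "Z \<in> \<Z>" "Z \<subseteq> X" for Z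
      proof -
        have "hit_by (below f Z \<union> f Z) Z" using \<Z> IH that by (intro hit) auto
        moreover have "below f Z \<union> f Z \<subseteq> below f X"
        proof -
          have "below f Z \<subseteq> below f X"
          proof
            fix A assume "A \<in> below f Z"
            then obtain Y where Y: "A \<in> f Y" "Y \<in> ?P" "(Y, Z) \<in> r" using belowE by metis
            have "(Y, X) \<in> r" using traceable_trans[OF tr] Y \<Z>[OF that(1)] X by metis
            then show "A \<in> below f X" using Y by (intro belowI)
          qed
          moreover have "f Z \<subseteq> below f X" using belowI \<Z>[OF that(1)] by blast
          ultimately show ?thesis by blast
        qed
        ultimately have "hit_by (below f X) Z" by (rule hit_by_mono)
        moreover have "\<not> (\<exists>A\<in>below f X. A \<subseteq> Z)" using nhit that(2) unfolding hit_by_def by blast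
        ultimately show ?thesis unfolding hit_by_def by metis
      qed
      then obtain \<F> where \<F>: "\<And>Z. Z \<in> \<Z> \<Longrightarrow> Z \<subseteq> X \<Longrightarrow>
          \<F> Z \<subseteq> below f X \<and> finite (\<F> Z) \<and> finite (Z - \<Union>(\<F> Z))" by metis
      \<comment> \<open>The countably many sets to avoid explicitly: the finite almost-covers of the
        controlling subsets of \<open>X\<close>, and the members added at controlling
        stages.\<close>
      define \<C> where "\<C> = (\<Union>Z\<in>{Z\<in>\<Z>. Z \<subseteq> X}. \<F> Z) \<union> (\<Union>Y\<in>\<Z>. f Y)"
      have "countable (f Y)" if "Y \<in> \<Z>" for Y
        using IH[of Y] \<Z>[OF that] by (auto simp: step_def)
      moreover have "countable (\<F> Z)" if "Z \<in> \<Z>" "Z \<subseteq> X" for Z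
        using \<F>[OF that] by (simp add: countable_finite)
      moreover have "countable {Z\<in>\<Z>. Z \<subseteq> X}" by (rule countable_subset[OF _ c\<Z>]) blast
      ultimately have "countable \<C>" unfolding \<C>_def using c\<Z> by (intro countable_Un countable_UN) auto
      have "f Y \<subseteq> below f X" if "Y \<in> \<Z>" for Y using belowI \<Z>[OF that] by blast
      then have \<C>_sub: "\<C> \<subseteq> below f X" unfolding \<C>_def using \<F> by blast
      have "infinite (X - \<Union>\<G>)" if "\<G> \<subseteq> \<C>" "finite \<G>" for \<G>
        using nhit that \<C>_sub unfolding hit_by_def by blast
      then obtain B where B: "B \<subseteq> X" "infinite B" "\<And>C. C \<in> \<C> \<Longrightarrow> finite (B \<inter> C)"
        using almost_disjoint_subset[OF ctbl_subsetsD(2)[OF X] \<open>countable \<C>\<close>] by metis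
      have "finite (B \<inter> A)" if A: "A \<in> below f X" for A
      proof (cases "A \<in> \<C>")
        case True
        then show ?thesis using B by blast
      next
        case False
        obtain Y where Y: "A \<in> f Y" "Y \<in> ?P" "(Y, X) \<in> r" using belowE[OF A] by metis
        \<comment> \<open>A member outside \<open>\<C>\<close> needs no avoiding, because its trace
          on \<open>X\<close> is already finite.\<close>
        have "finite (A \<inter> X)"
        proof (rule ccontr)
          assume inf: "infinite (A \<inter> X)"
          have "A \<inter> X \<subseteq> Y \<inter> X" using sub(1)[OF Y(1,2) IH[OF Y(3)]] by blast
          then have "infinite (Y \<inter> X)" using inf finite_subset by blast
          moreover have "Y \<notin> \<Z>" using False Y unfolding \<C>_def by blast
          ultimately obtain Z where Z: "Z \<in> \<Z>" "Y \<inter> X \<subseteq> Z" "Z \<subseteq> X" using trace Y by metis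
          note FZ = \<F>[OF Z(1,3)]
          have "finite (A \<inter> D)" if D: "D \<in> \<F> Z" for D
          proof -
            have "A \<noteq> D" using False D Z unfolding \<C>_def by blast
            obtain Y' where Y': "D \<in> f Y'" "Y' \<in> ?P" "(Y', X) \<in> r"
              using belowE[of D f X] FZ D by blast
            show ?thesis
              using ad[OF Y(1) Y'(1) \<open>A \<noteq> D\<close> Y(2) Y'(2) IH[OF Y(3)] IH[OF Y'(3)]] .
          qed
          then have "finite (\<Union>D\<in>\<F> Z. A \<inter> D)" using FZ by blast
          moreover have "A \<inter> X \<subseteq> (Z - \<Union>(\<F> Z)) \<union> (\<Union>D\<in>\<F> Z. A \<inter> D)"
            using \<open>A \<inter> X \<subseteq> Y \<inter> X\<close> Z by blast
          ultimately have "finite (A \<inter> X)" using FZ finite_subset finite_UnI by metis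
          then show False using inf by blast
        qed
        moreover have "B \<inter> A \<subseteq> A \<inter> X" using B by blast
        ultimately show ?thesis using finite_subset by blast
      qed
      then have "step f X {B}" using B unfolding step_def by blast
      then show ?thesis ..
    qed
  qed
  then obtain f where f: "\<And>X. step f X (f X)" by metis
  define \<A> where "\<A> = (\<Union>X\<in>?P. f X)"
  have "A \<in> ?P" if A: "A \<in> \<A>" for A
  proof -
    obtain X where X: "X \<in> ?P" "A \<in> f X" using A by (auto simp: \<A>_def)
    then show ?thesis using sub[OF X(2,1) f] ctbl_subsets_mono by blast
  qed
  moreover have "almost_disjoint \<A>"
    unfolding almost_disjoint_def
  proof (intro ballI impI)
    fix A B assume "A \<in> \<A>" "B \<in> \<A>" "A \<noteq> B"
    then show "finite (A \<inter> B)" unfolding \<A>_def using ad[OF _ _ _ _ _ f f] by blast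
  qed
  moreover have "saturated K \<A>"
    unfolding saturated_def hit_by_def[symmetric]
  proof
    fix X assume X: "X \<in> ?P"
    have "below f X \<union> f X \<subseteq> \<A>" using X by (auto simp: \<A>_def below_def)
    then show "hit_by \<A> X" using hit[OF X f] hit_by_mono by metis
  qed
  ultimately show ?thesis unfolding SAT_def by blast
qed

text \<open>The members will be the supports of a base of the cube, where inclusion of cylinders
  reverses inclusion of supports. Countably many members below each one thus means countably many
  basic supersets.\<close>

lemma traceable_imp_sparse_cofinal:
  fixes K :: "'a set"
  assumes tr: "traceable K r"
  shows "\<exists>\<A>\<subseteq>ctbl_subsets K. (\<forall>X\<in>ctbl_subsets K. \<exists>A\<in>\<A>. X \<subseteq> A) \<and>
           (\<forall>A\<in>\<A>. countable {B\<in>\<A>. B \<subseteq> A})"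
proof -
  let ?P = "ctbl_subsets K"
  define \<A> where "\<A> = {X\<in>?P. \<forall>Y\<in>?P. (Y, X) \<in> r \<longrightarrow> \<not> X \<subseteq> Y}"
  \<comment> \<open>A member of \<open>\<A>\<close> contained in an earlier set \<open>Z\<close> does not come after \<open>Z\<close>, so the members below
    \<open>X\<close> can be counted by induction along \<open>r\<close>.\<close>
  have "\<exists>A\<in>\<A>. X \<subseteq> A" if X: "X \<in> ?P" for X
  proof -
    have "X \<in> ?P \<and> X \<subseteq> X" using X by blast
    \<comment> \<open>The \<open>r\<close>-first superset of \<open>X\<close> lies in
      \<open>\<A>\<close>, since an earlier set covering it would also cover
      \<open>X\<close>.\<close>
    from wf_least[of r "\<lambda>Y. Y \<in> ?P \<and> X \<subseteq> Y", OF traceableD(1)[OF tr] this]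
    obtain A where "A \<in> ?P \<and> X \<subseteq> A" "\<And>Y. (Y, A) \<in> r \<Longrightarrow> \<not> (Y \<in> ?P \<and> X \<subseteq> Y)" by metis
    then have "A \<in> \<A>" "X \<subseteq> A" unfolding \<A>_def by blast+
    then show ?thesis by blast
  qed
  \<comment> \<open>The count is made for all \<open>X\<close>, since controlling sets need not
    belong to \<open>\<A>\<close>, and it leaves out members that come after \<open>X\<close>. For
    \<open>X\<close> in \<open>\<A>\<close> nothing is left out.\<close>
  moreover have "X \<in> ?P \<longrightarrow> countable {B\<in>\<A>. B \<subseteq> X \<and> (X, B) \<notin> r}" for X
  proof (induction X rule: wf_induct_rule[OF traceableD(1)[OF tr]])
    case (1 X)
    show ?case
    proof
      assume X: "X \<in> ?P"
      obtain \<Z> where c\<Z>: "countable \<Z>" and \<Z>: "\<And>Z. Z \<in> \<Z> \<Longrightarrow> Z \<in> ?P \<and> (Z, X) \<in> r"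
        and trace: "\<And>Y. Y \<in> ?P \<Longrightarrow> (Y, X) \<in> r \<Longrightarrow> infinite (Y \<inter> X) \<Longrightarrow>
           Y \<in> \<Z> \<or> (\<exists>Z\<in>\<Z>. Y \<inter> X \<subseteq> Z \<and> Z \<subseteq> X)"
        using traceableD(3)[OF tr X] by metis
      have "{B\<in>\<A>. B \<subseteq> X \<and> (X, B) \<notin> r} \<subseteq>
              insert X (\<Z> \<union> (\<Union>Z\<in>\<Z>. {B\<in>\<A>. B \<subseteq> Z \<and> (Z, B) \<notin> r}))"
      proof
        fix B assume "B \<in> {B\<in>\<A>. B \<subseteq> X \<and> (X, B) \<notin> r}"
        then have B: "B \<in> \<A>" "B \<subseteq> X" "(X, B) \<notin> r" "B \<in> ?P" by (auto simp: \<A>_def)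
        have "B = X \<or> (B, X) \<in> r" using traceableD(2)[OF tr X B(4)] B by blast
        moreover have "B \<in> \<Z> \<or> (\<exists>Z\<in>\<Z>. B \<subseteq> Z)" if "(B, X) \<in> r"
        proof -
          have "B \<inter> X = B" using B by blast
          then show ?thesis using trace[OF B(4) that] ctbl_subsetsD(3)[OF B(4)] by metis
        qed
        moreover have "(Z, B) \<notin> r" if "Z \<in> \<Z>" "B \<subseteq> Z" for Z
          using B(1) \<Z>[OF that(1)] that(2) by (auto simp: \<A>_def)
        ultimately show "B \<in> insert X (\<Z> \<union> (\<Union>Z\<in>\<Z>. {B\<in>\<A>. B \<subseteq> Z \<and> (Z, B) \<notin> r}))"
          using B(1) by blast
      qed
      moreover have "countable (insert X (\<Z> \<union> (\<Union>Z\<in>\<Z>. {B\<in>\<A>. B \<subseteq> Z \<and> (Z, B) \<notin> r})))"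
        using c\<Z> \<Z> 1 by auto
      ultimately show "countable {B\<in>\<A>. B \<subseteq> X \<and> (X, B) \<notin> r}" by (rule countable_subset)
    qed
  qed
  moreover have "{B\<in>\<A>. B \<subseteq> X} = {B\<in>\<A>. B \<subseteq> X \<and> (X, B) \<notin> r}" if "X \<in> \<A>" for X
    using that by (auto simp: \<A>_def)
  moreover have "\<A> \<subseteq> ?P" by (auto simp: \<A>_def)
  ultimately show ?thesis by (intro exI[of _ \<A>]) (auto simp: \<A>_def)
qed

section \<open>The \<open>G\<^sub>\<delta>\<close>-modification of the Cantor cube\<close>

abbreviation cantor_delta :: "'a set \<Rightarrow> ('a \<Rightarrow> bool) topology" where
  "cantor_delta K \<equiv> gdelta_modification (product_topology (\<lambda>_. discrete_topology (UNIV :: bool set)) K)"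

text \<open>These are cylinders; with countable support \<open>A\<close> they serve as basic open
  sets of the modified cube.\<close>

definition agree :: "'a set \<Rightarrow> ('a \<Rightarrow> bool) \<Rightarrow> 'a set \<Rightarrow> ('a \<Rightarrow> bool) set" where
  "agree K x A = {y \<in> K \<rightarrow>\<^sub>E UNIV. \<forall>a\<in>A. y a = x a}"

lemma agree_subset: "agree K x A \<subseteq> K \<rightarrow>\<^sub>E UNIV"
  by (auto simp: agree_def)

lemma agree_self: "x \<in> K \<rightarrow>\<^sub>E UNIV \<Longrightarrow> x \<in> agree K x A"
  by (simp add: agree_def)

lemma agree_antimono: "A \<subseteq> B \<Longrightarrow> agree K x B \<subseteq> agree K x A"
  by (auto simp: agree_def)

lemma agree_eq: "x \<in> agree K y A \<Longrightarrow> agree K y A = agree K x A"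
  by (auto simp: agree_def)

text \<open>For a coordinate in \<open>A - B\<close>, flipping the value of \<open>x\<close> there
  gives a point of \<open>agree K x B\<close> outside \<open>agree K x A\<close>; the assumption
  \<open>A \<subseteq> K\<close> keeps it in the cube.\<close>

lemma agree_subset_iff:
  assumes "x \<in> K \<rightarrow>\<^sub>E UNIV" "A \<subseteq> K"
  shows "agree K x B \<subseteq> agree K x A \<longleftrightarrow> A \<subseteq> B"
proof
  assume sub: "agree K x B \<subseteq> agree K x A"
  show "A \<subseteq> B"
  proof
    fix a assume a: "a \<in> A"
    show "a \<in> B"
    proof (rule ccontr)
      assume "a \<notin> B"
      then have "x(a := \<not> x a) \<in> agree K x B"
        using assms a by (auto simp: agree_def PiE_iff extensional_def)
      then have "x(a := \<not> x a) \<in> agree K x A" using sub by blast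
      then show False using a by (auto simp: agree_def)
    qed
  qed
qed (rule agree_antimono)

lemma gdelta_agree:
  assumes A: "A \<subseteq> K" "countable A"
  shows "gdelta_in (product_topology (\<lambda>_. discrete_topology (UNIV :: bool set)) K) (agree K x A)"
\<comment> \<open>An empty intersection would be the whole function type rather than the cube, so
  the empty support is treated apart.\<close>
proof (cases "A = {}")
  case True
  then have "agree K x A = topspace (product_topology (\<lambda>_. discrete_topology (UNIV :: bool set)) K)"
    by (auto simp: agree_def)
  then show ?thesis by (metis gdelta_in_topspace)
next
  case False
  let ?T = "product_topology (\<lambda>_. discrete_topology (UNIV :: bool set)) K"
  have "gdelta_in ?T {y \<in> K \<rightarrow>\<^sub>E UNIV. y a = x a}" if "a \<in> A" for a
  proof (rule open_imp_gdelta_in)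
    have "a \<in> K" using that A by blast
    then have "openin ?T {y \<in> topspace ?T. y a \<in> {x a}}"
      by (intro openin_continuous_map_preimage[OF continuous_map_product_projection]) auto
    then show "openin ?T {y \<in> K \<rightarrow>\<^sub>E UNIV. y a = x a}" by simp
  qed
  then have "gdelta_in ?T (\<Inter>a\<in>A. {y \<in> K \<rightarrow>\<^sub>E UNIV. y a = x a})"
    using False A by (intro gdelta_in_Inter) auto
  moreover have "(\<Inter>a\<in>A. {y \<in> K \<rightarrow>\<^sub>E UNIV. y a = x a}) = agree K x A"
    using False by (auto simp: agree_def)
  ultimately show ?thesis by simp
qed

text \<open>An open set of the cube depends near a point on finitely many coordinates. A
  \<open>G\<^sub>\<delta>\<close> set therefore depends near each of its points on countably many,
  and this property survives the generation of the topology. Conversely, cylinders of countable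
  support are themselves \<open>G\<^sub>\<delta>\<close>.\<close>

lemma openin_cantor_delta:
  "openin (cantor_delta K) S \<longleftrightarrow>
     (S \<subseteq> K \<rightarrow>\<^sub>E UNIV \<and> (\<forall>x\<in>S. \<exists>A\<subseteq>K. countable A \<and> agree K x A \<subseteq> S))"
proof
  let ?T = "product_topology (\<lambda>_. discrete_topology (UNIV :: bool set)) K"
  assume "openin (cantor_delta K) S"
  then have "generate_topology_on {S. gdelta_in ?T S} S"
    by (simp add: gdelta_modification_def openin_topology_generated_by_iff)
  then show "S \<subseteq> K \<rightarrow>\<^sub>E UNIV \<and> (\<forall>x\<in>S. \<exists>A\<subseteq>K. countable A \<and> agree K x A \<subseteq> S)"
  proof (induction rule: generate_topology_on.induct)
    case Empty
    then show ?case by simp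
  next
    case (Int a b)
    show ?case
    proof (intro conjI ballI)
      show "a \<inter> b \<subseteq> K \<rightarrow>\<^sub>E UNIV" using Int by blast
      fix x assume "x \<in> a \<inter> b"
      then obtain A B where "A \<subseteq> K" "countable A" "agree K x A \<subseteq> a" "B \<subseteq> K" "countable B" "agree K x B \<subseteq> b"
        using Int.IH by (meson IntD1 IntD2)
      moreover have "agree K x (A \<union> B) \<subseteq> agree K x A \<inter> agree K x B" by (auto simp: agree_def)
      ultimately have "A \<union> B \<subseteq> K" "countable (A \<union> B)" "agree K x (A \<union> B) \<subseteq> a \<inter> b" by blast+
      then show "\<exists>A\<subseteq>K. countable A \<and> agree K x A \<subseteq> a \<inter> b" by blast
    qed
  next
    case (UN \<K>)
    show ?case
    proof (intro conjI ballI)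
      show "\<Union>\<K> \<subseteq> K \<rightarrow>\<^sub>E UNIV" using UN.IH by blast
      fix x assume "x \<in> \<Union>\<K>"
      then obtain k where "k \<in> \<K>" "x \<in> k" by blast
      then obtain A where "A \<subseteq> K" "countable A" "agree K x A \<subseteq> k" using UN.IH by meson
      then show "\<exists>A\<subseteq>K. countable A \<and> agree K x A \<subseteq> \<Union>\<K>" using \<open>k \<in> \<K>\<close> by blast
    qed
  next
    case (Basis s)
    then have g: "s \<subseteq> topspace ?T" "(countable intersection_of openin ?T) s"
      by (auto simp: gdelta_in_alt)
    then obtain \<U> where \<U>: "countable \<U>" "\<U> \<subseteq> {U. openin ?T U}" "\<Inter>\<U> = s"
      by (auto simp: intersection_of_def)
    show ?case
    proof (intro conjI ballI)
      show "s \<subseteq> K \<rightarrow>\<^sub>E UNIV" using g by simp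
      fix x assume x: "x \<in> s"
      then have xK: "x \<in> K \<rightarrow>\<^sub>E UNIV" using g by auto
      have "\<exists>A\<subseteq>K. finite A \<and> agree K x A \<subseteq> U" if "U \<in> \<U>" for U
      proof -
        have "openin ?T U" "x \<in> U" using that \<U> x by auto
        then obtain V where V: "finite {i \<in> K. V i \<noteq> (UNIV :: bool set)}" "x \<in> Pi\<^sub>E K V" "Pi\<^sub>E K V \<subseteq> U"
          unfolding openin_product_topology_alt by auto
        have "agree K x {i \<in> K. V i \<noteq> UNIV} \<subseteq> Pi\<^sub>E K V"
        proof
          fix y assume y: "y \<in> agree K x {i \<in> K. V i \<noteq> UNIV}"
          have "y i \<in> V i" if "i \<in> K" for i
            using y V(2) that by (cases "V i = UNIV") (auto simp: agree_def PiE_iff)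
          then show "y \<in> Pi\<^sub>E K V" using y by (auto simp: agree_def PiE_iff)
        qed
        then show ?thesis using V by (intro exI[of _ "{i \<in> K. V i \<noteq> UNIV}"]) auto
      qed
      then obtain A where A: "\<And>U. U \<in> \<U> \<Longrightarrow> A U \<subseteq> K \<and> finite (A U) \<and> agree K x (A U) \<subseteq> U" by metis
      define B where "B = (\<Union>U\<in>\<U>. A U)"
      have "B \<subseteq> K" using A by (auto simp: B_def)
      moreover have "countable B" unfolding B_def using \<U> A by (intro countable_UN) (auto simp: countable_finite)
      moreover have "agree K x B \<subseteq> s"
      proof
        fix y assume y: "y \<in> agree K x B"
        have "y \<in> U" if "U \<in> \<U>" for U
        proof -
          have "A U \<subseteq> B" using that by (auto simp: B_def)
          then have "y \<in> agree K x (A U)" using agree_antimono y by blast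
          then show ?thesis using A[OF that] by blast
        qed
        then show "y \<in> s" using \<U>(3) by blast
      qed
      ultimately show "\<exists>A\<subseteq>K. countable A \<and> agree K x A \<subseteq> s" by blast
    qed
  qed
next
  let ?T = "product_topology (\<lambda>_. discrete_topology (UNIV :: bool set)) K"
  assume S: "S \<subseteq> K \<rightarrow>\<^sub>E UNIV \<and> (\<forall>x\<in>S. \<exists>A\<subseteq>K. countable A \<and> agree K x A \<subseteq> S)"
  have "\<exists>U. openin (cantor_delta K) U \<and> x \<in> U \<and> U \<subseteq> S" if x: "x \<in> S" for x
  proof -
    obtain A where A: "A \<subseteq> K" "countable A" "agree K x A \<subseteq> S" using S x by blast
    have "openin (cantor_delta K) (agree K x A)"
      unfolding gdelta_modification_def
      by (rule topology_generated_by_Basis) (use gdelta_agree A in blast)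
    moreover have "x \<in> agree K x A" using x S by (intro agree_self) blast
    ultimately show ?thesis using A by blast
  qed
  then show "openin (cantor_delta K) S" by (subst openin_subopen) blast
qed

lemma openin_agree:
  assumes "A \<subseteq> K" "countable A"
  shows "openin (cantor_delta K) (agree K x A)"
  unfolding openin_cantor_delta
proof (intro conjI ballI)
  show "agree K x A \<subseteq> K \<rightarrow>\<^sub>E UNIV" by (rule agree_subset)
  fix y assume "y \<in> agree K x A"
  then have "agree K y A \<subseteq> agree K x A" using agree_eq by blast
  then show "\<exists>B\<subseteq>K. countable B \<and> agree K y B \<subseteq> agree K x A" using assms by blast
qed

text \<open>The base consists of the cylinders with support in \<open>\<A>\<close>. A basic superset
  of \<open>agree K x A\<close> contains \<open>x\<close>, so it can be recentred at
  \<open>x\<close>, and its support is then a member of \<open>\<A>\<close> below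
  \<open>A\<close>.\<close>

lemma nt_witness_cantor_delta:
  fixes K :: "'a set"
  assumes inf: "infinite K"
    and \<A>: "\<A> \<subseteq> ctbl_subsets K" and cof: "\<And>X. X \<in> ctbl_subsets K \<Longrightarrow> \<exists>A\<in>\<A>. X \<subseteq> A"
    and sparse: "\<And>A. A \<in> \<A> \<Longrightarrow> countable {B\<in>\<A>. B \<subseteq> A}"
  shows "nt_witness (cantor_delta K) (cardSuc natLeq)"
  unfolding nt_witness_def
proof (intro exI conjI ballI)
  define \<B> where "\<B> = {agree K x A | x A. x \<in> K \<rightarrow>\<^sub>E UNIV \<and> A \<in> \<A>}"
  obtain C where C: "C \<subseteq> K" "countable C" "infinite C"
    using infinite_countable_subset'[OF inf] by blast
  show "is_base (cantor_delta K) \<B>"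
    unfolding is_base_def openin_topology_base_unique
  proof (intro conjI allI impI)
    fix V assume "V \<in> \<B>"
    then show "openin (cantor_delta K) V"
      using \<A> by (auto simp: \<B>_def ctbl_subsets_def intro!: openin_agree)
  next
    fix U x assume Ux: "openin (cantor_delta K) U \<and> x \<in> U"
    then obtain A where A: "A \<subseteq> K" "countable A" "agree K x A \<subseteq> U" and xK: "x \<in> K \<rightarrow>\<^sub>E UNIV"
      unfolding openin_cantor_delta by blast
    \<comment> \<open>Adding the infinite set \<open>C\<close> turns a possibly finite support into
      an element of \<open>ctbl_subsets K\<close>, where cofinality applies.\<close>
    have "A \<union> C \<in> ctbl_subsets K" using A C by (intro ctbl_subsetsI) auto
    then obtain B where B: "B \<in> \<A>" "A \<union> C \<subseteq> B" using cof by blast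
    have "agree K x B \<subseteq> U" using A agree_antimono[of A B K x] B by blast
    moreover have "agree K x B \<in> \<B>" using B xK by (auto simp: \<B>_def)
    ultimately show "\<exists>V. V \<in> \<B> \<and> x \<in> V \<and> V \<subseteq> U" using agree_self[OF xK] by blast
  qed
  fix B assume "B \<in> \<B>"
  then obtain x A where xA: "B = agree K x A" "x \<in> K \<rightarrow>\<^sub>E UNIV" "A \<in> \<A>" by (auto simp: \<B>_def)
  have "{B' \<in> \<B>. B \<subseteq> B'} \<subseteq> agree K x ` {D\<in>\<A>. D \<subseteq> A}"
  proof
    fix B' assume "B' \<in> {B' \<in> \<B>. B \<subseteq> B'}"
    then obtain y D where yD: "B' = agree K y D" "D \<in> \<A>" and sub: "B \<subseteq> B'" by (auto simp: \<B>_def)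
    have "x \<in> agree K y D" using agree_self[OF xA(2)] sub xA yD by blast
    then have eq: "B' = agree K x D" using agree_eq yD by metis
    have "D \<subseteq> K" using \<A> yD by (auto simp: ctbl_subsets_def)
    then have "D \<subseteq> A" using agree_subset_iff[OF xA(2)] sub eq xA by metis
    then show "B' \<in> agree K x ` {D\<in>\<A>. D \<subseteq> A}" using eq yD by blast
  qed
  then have "countable {B' \<in> \<B>. B \<subseteq> B'}"
    using sparse[OF xA(3)] by (meson countable_image countable_subset)
  then show "card_of {B' \<in> \<B>. B \<subseteq> B'} <o cardSuc natLeq"
    by (simp add: cardSuc_ordLeq_ordLess natLeq_Card_order card_of_Card_order countable_card_le_natLeq)
qed

text \<open>Countable intersections of open sets are open here, so infinitely many basic neighbourhoods of
  one point have a common basic subset.\<close>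
lemma base_cantor_delta_infinite_supersets:
  fixes K :: "'a set"
  assumes unc: "uncountable K" and base: "is_base (cantor_delta K) \<B>"
  shows "\<exists>B\<in>\<B>. infinite {B'\<in>\<B>. B \<subseteq> B'}"
proof -
  have bo: "openin (cantor_delta K) V" if "V \<in> \<B>" for V
    using base that unfolding is_base_def openin_topology_base_unique by blast
  have bb: "\<exists>V. V \<in> \<B> \<and> x \<in> V \<and> V \<subseteq> U" if "openin (cantor_delta K) U" "x \<in> U" for U x
    using base that unfolding is_base_def openin_topology_base_unique by blast
  define x :: "'a \<Rightarrow> bool" where "x = (\<lambda>a\<in>K. False)"
  have xK: "x \<in> K \<rightarrow>\<^sub>E UNIV" by (simp add: x_def)
  define \<S> where "\<S> = {B\<in>\<B>. x \<in> B}"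
  have inter: "\<exists>A\<subseteq>K. countable A \<and> agree K x A \<subseteq> \<Inter>\<T>" if \<T>: "\<T> \<subseteq> \<S>" "countable \<T>" for \<T>
  proof -
    have "\<exists>A\<subseteq>K. countable A \<and> agree K x A \<subseteq> B" if "B \<in> \<T>" for B
      using bo[of B] that \<T> unfolding openin_cantor_delta \<S>_def by blast
    then obtain A where A: "\<And>B. B \<in> \<T> \<Longrightarrow> A B \<subseteq> K \<and> countable (A B) \<and> agree K x (A B) \<subseteq> B" by metis
    have "agree K x (\<Union>B\<in>\<T>. A B) \<subseteq> B" if "B \<in> \<T>" for B
      using A[OF that] agree_antimono[of "A B" "\<Union>B\<in>\<T>. A B" K x] that by blast
    moreover have "countable (\<Union>B\<in>\<T>. A B)" using \<T> A by (intro countable_UN) auto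
    moreover have "(\<Union>B\<in>\<T>. A B) \<subseteq> K" using A by blast
    ultimately show ?thesis by (intro exI[of _ "\<Union>B\<in>\<T>. A B"]) blast
  qed
  \<comment> \<open>Finitely many basic sets at \<open>x\<close> would all include one cylinder of
    countable support \<open>A\<close>, which does not fit into the cylinder given by a coordinate
    \<open>b\<close> outside \<open>A\<close>.\<close>
  have "infinite \<S>"
  proof
    assume "finite \<S>"
    then have "countable \<S>" by (rule countable_finite)
    from inter[OF subset_refl this]
    obtain A where A: "A \<subseteq> K" "countable A" "agree K x A \<subseteq> \<Inter>\<S>" by blast
    have "\<not> K \<subseteq> A" using unc A(2) by (metis countable_subset)
    then obtain b where b: "b \<in> K" "b \<notin> A" by blast
    obtain V where "V \<in> \<B>" "x \<in> V" "V \<subseteq> agree K x {b}"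
      using bb[OF openin_agree[of "{b}" K x] agree_self[OF xK]] b by auto
    then have "agree K x A \<subseteq> agree K x {b}" using A unfolding \<S>_def by blast
    then have "{b} \<subseteq> A" using agree_subset_iff[OF xK, of "{b}" A] b by blast
    then show False using b by blast
  qed
  then obtain \<T> where \<T>: "\<T> \<subseteq> \<S>" "countable \<T>" "infinite \<T>"
    using infinite_countable_subset'[of \<S>] by blast
  obtain A where A: "A \<subseteq> K" "countable A" "agree K x A \<subseteq> \<Inter>\<T>" using inter[OF \<T>(1,2)] by blast
  obtain B where B: "B \<in> \<B>" "x \<in> B" "B \<subseteq> agree K x A"
    using bb[OF openin_agree[OF A(1,2)] agree_self[OF xK]] by blast
  have "\<T> \<subseteq> {B'\<in>\<B>. B \<subseteq> B'}" using B A \<T> unfolding \<S>_def by blast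
  then show ?thesis using \<T>(3) B(1) finite_subset by blast
qed

text \<open>For the lower bound: a cardinal below \<open>\<omega>\<^sub>1\<close> is at most
  \<open>\<omega>\<close>, so a base witnessing it would have only finitely many members above each
  of its members.\<close>

lemma sparse_cofinal_imp_Nt:
  fixes K :: "'a set"
  assumes unc: "uncountable K"
    and "\<A> \<subseteq> ctbl_subsets K" "\<And>X. X \<in> ctbl_subsets K \<Longrightarrow> \<exists>A\<in>\<A>. X \<subseteq> A"
    and "\<And>A. A \<in> \<A> \<Longrightarrow> countable {B\<in>\<A>. B \<subseteq> A}"
  shows "Nt K"
  unfolding Nt_def Nt_eq_omega1_def
proof (intro conjI allI impI notI)
  have "infinite K" using unc countable_finite by blast
  then show "nt_witness (cantor_delta K) (cardSuc natLeq)"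
    using assms by (intro nt_witness_cantor_delta)
next
  fix \<mu> :: "nat rel"
  assume \<mu>: "Card_order \<mu> \<and> \<mu> <o cardSuc natLeq" and nt: "nt_witness (cantor_delta K) \<mu>"
  obtain \<B> where \<B>: "is_base (cantor_delta K) \<B> \<and> (\<forall>B\<in>\<B>. card_of {B'\<in>\<B>. B \<subseteq> B'} <o \<mu>)"
    using nt unfolding nt_witness_def ..
  have "\<mu> \<le>o natLeq" using \<mu> cardSuc_ordLeq_ordLess[OF natLeq_Card_order, of \<mu>] by blast
  then have "finite {B'\<in>\<B>. B \<subseteq> B'}" if "B \<in> \<B>" for B
    using \<B> that ordLess_ordLeq_trans by (auto simp: finite_iff_ordLess_natLeq)
  then show False using base_cantor_delta_infinite_supersets[OF unc] \<B> by blast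
qed

section \<open>Comonotone enumerations and permutation groups\<close>

text \<open>The colouring \<open>c\<close> cuts \<open>S\<close> into finitely many pieces on which
  \<open>u\<close> and \<open>v\<close> induce the same order. Colours are natural numbers so that
  two colourings can be coded into one.\<close>

definition comonotone :: "('a \<Rightarrow> nat) \<Rightarrow> ('a \<Rightarrow> nat) \<Rightarrow> 'a set \<Rightarrow> bool" where
  "comonotone u v S \<longleftrightarrow> (\<exists>c :: 'a \<Rightarrow> nat. finite (c ` S) \<and>
     (\<forall>x\<in>S. \<forall>y\<in>S. c x = c y \<longrightarrow> (u x < u y \<longleftrightarrow> v x < v y)))"

lemma comonotoneI:
  assumes "\<And>x y. x \<in> S \<Longrightarrow> y \<in> S \<Longrightarrow> u x < u y \<longleftrightarrow> v x < v y"
  shows "comonotone u v S"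
  unfolding comonotone_def
proof (intro exI conjI)
  show "finite ((\<lambda>_. 0 :: nat) ` S)" by (rule finite_subset[of _ "{0}"]) auto
qed (use assms in blast)

lemma comonotone_refl: "comonotone u u S"
  by (rule comonotoneI) simp

lemma comonotone_sym: "comonotone u v S \<Longrightarrow> comonotone v u S"
  by (auto simp: comonotone_def)

lemma comonotone_subset: "comonotone u v T \<Longrightarrow> S \<subseteq> T \<Longrightarrow> comonotone u v S"
  unfolding comonotone_def by (meson finite_subset image_mono subsetD)

lemma comonotone_cong:
  assumes "comonotone u v S" "\<And>x. x \<in> S \<Longrightarrow> u x = u' x" "\<And>x. x \<in> S \<Longrightarrow> v x = v' x"
  shows "comonotone u' v' S"
  using assms by (simp add: comonotone_def)

text \<open>The two colourings have a common refinement, obtained by pairing their colours.\<close>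

lemma comonotone_trans:
  fixes u v :: "'a \<Rightarrow> nat"
  assumes "comonotone u v S" "comonotone v w S"
  shows "comonotone u w S"
proof -
  obtain c :: "'a \<Rightarrow> nat" where c: "finite (c ` S) \<and> (\<forall>x\<in>S. \<forall>y\<in>S. c x = c y \<longrightarrow> (u x < u y \<longleftrightarrow> v x < v y))"
    using assms(1) unfolding comonotone_def ..
  obtain d :: "'a \<Rightarrow> nat" where d: "finite (d ` S) \<and> (\<forall>x\<in>S. \<forall>y\<in>S. d x = d y \<longrightarrow> (v x < v y \<longleftrightarrow> w x < w y))"
    using assms(2) unfolding comonotone_def ..
  have "(\<lambda>x. prod_encode (c x, d x)) ` S \<subseteq> prod_encode ` (c ` S \<times> d ` S)" by auto
  then have "finite ((\<lambda>x. prod_encode (c x, d x)) ` S)"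
    by (rule finite_subset) (use c d in auto)
  then show ?thesis
    unfolding comonotone_def using c d by (intro exI[of _ "\<lambda>x. prod_encode (c x, d x)"]) simp
qed

text \<open>Parity keeps the colours used on \<open>S\<close> apart from those used on
  \<open>T - S\<close>.\<close>

lemma comonotone_Un:
  fixes u v :: "'a \<Rightarrow> nat"
  assumes "comonotone u v S" "comonotone u v T"
  shows "comonotone u v (S \<union> T)"
proof -
  obtain c :: "'a \<Rightarrow> nat" where c: "finite (c ` S) \<and> (\<forall>x\<in>S. \<forall>y\<in>S. c x = c y \<longrightarrow> (u x < u y \<longleftrightarrow> v x < v y))"
    using assms(1) unfolding comonotone_def ..
  obtain d :: "'a \<Rightarrow> nat" where d: "finite (d ` T) \<and> (\<forall>x\<in>T. \<forall>y\<in>T. d x = d y \<longrightarrow> (u x < u y \<longleftrightarrow> v x < v y))"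
    using assms(2) unfolding comonotone_def ..
  define b where "b x = (if x \<in> S then 2 * c x else Suc (2 * d x))" for x
  have "b ` (S \<union> T) \<subseteq> (\<lambda>n. 2 * n) ` c ` S \<union> (\<lambda>n. Suc (2 * n)) ` d ` T"
    by (auto simp: b_def)
  then have "finite (b ` (S \<union> T))" by (rule finite_subset) (use c d in auto)
  moreover have "u x < u y \<longleftrightarrow> v x < v y" if "x \<in> S \<union> T" "y \<in> S \<union> T" "b x = b y" for x y
  proof -
    have "x \<in> S \<longleftrightarrow> y \<in> S" using that(3) by (simp add: b_def split: if_splits) presburger+
    then show ?thesis using that c d by (auto simp: b_def)
  qed
  ultimately show ?thesis unfolding comonotone_def by blast
qed

lemma comonotone_UN:
  assumes "finite I" "\<And>i. i \<in> I \<Longrightarrow> comonotone u v (S i)"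
  shows "comonotone u v (\<Union>i\<in>I. S i)"
  using assms
proof (induction I rule: finite_induct)
  case empty
  show ?case by (rule comonotoneI) simp
next
  case (insert i I)
  then show ?case by (simp add: comonotone_Un)
qed

lemma comonotone_finite:
  assumes "finite S"
  shows "comonotone u v S"
proof -
  have "comonotone u v (\<Union>x\<in>S. {x})" by (rule comonotone_UN[OF assms], rule comonotoneI) simp
  then show ?thesis by simp
qed

lemma comonotone_comp:
  fixes u v :: "'a \<Rightarrow> nat" and g :: "'b \<Rightarrow> 'a"
  assumes "comonotone u v T" "g ` S \<subseteq> T"
  shows "comonotone (u \<circ> g) (v \<circ> g) S"
proof -
  obtain c :: "'a \<Rightarrow> nat" where c: "finite (c ` T) \<and> (\<forall>x\<in>T. \<forall>y\<in>T. c x = c y \<longrightarrow> (u x < u y \<longleftrightarrow> v x < v y))"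
    using assms(1) unfolding comonotone_def ..
  have "(c \<circ> g) ` S \<subseteq> c ` T" using assms(2) by auto
  then have "finite ((c \<circ> g) ` S)" by (rule finite_subset) (use c in auto)
  moreover have "\<forall>x\<in>S. \<forall>y\<in>S. (c \<circ> g) x = (c \<circ> g) y \<longrightarrow> ((u \<circ> g) x < (u \<circ> g) y \<longleftrightarrow> (v \<circ> g) x < (v \<circ> g) y)"
  proof (intro ballI impI)
    fix x y assume "x \<in> S" "y \<in> S" "(c \<circ> g) x = (c \<circ> g) y"
    moreover have "g x \<in> T" "g y \<in> T" using \<open>x \<in> S\<close> \<open>y \<in> S\<close> assms(2) by auto
    ultimately show "(u \<circ> g) x < (u \<circ> g) y \<longleftrightarrow> (v \<circ> g) x < (v \<circ> g) y" using c by simp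
  qed
  ultimately show ?thesis unfolding comonotone_def by blast
qed

lemma triangle_less: "m < n \<Longrightarrow> triangle m + m < triangle n"
proof (induction n)
  case (Suc n)
  then show ?case by (cases "m = n") auto
qed simp

lemma prod_encode_less_iff: "prod_encode (a, b) < prod_encode (a, b') \<longleftrightarrow> b < b'"
proof -
  have "prod_encode (a, b) < prod_encode (a, b')" if "b < b'" for b b'
    using triangle_less[of "a + b" "a + b'"] that by (simp add: prod_encode_def)
  then show ?thesis by (metis less_asym linorder_less_linear less_irrefl)
qed

text \<open>Points are sorted into blocks by the first \<open>z n\<close> containing them, and each
  block is ordered by the corresponding \<open>v\<close>. On \<open>z n\<close> only the blocks
  \<open>0\<close> to \<open>n\<close> occur, so coherence is applied finitely often.\<close>

lemma comonotone_amalgam: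
  fixes v :: "nat \<Rightarrow> 'a \<Rightarrow> nat"
  assumes "countable X" and inj: "\<And>n. inj_on (v n) (z n)"
    and coh: "\<And>m n. comonotone (v m) (v n) (z m \<inter> z n)"
  shows "\<exists>u. inj_on u X \<and> (\<forall>n. comonotone u (v n) (X \<inter> z n))"
proof -
  obtain e0 :: "'a \<Rightarrow> nat" where e0: "inj_on e0 X" using assms(1) by (auto simp: countable_def)
  define d where "d x = (LEAST n. x \<in> z n)" for x
  have d: "x \<in> z (d x)" "d x \<le> n" if "x \<in> z n" for x n
    using that unfolding d_def by (auto intro: LeastI Least_le)
  define U where "U = (\<Union>n. z n)"
  \<comment> \<open>The first component records the block; \<open>Suc\<close> reserves
    \<open>0\<close> for the points outside every \<open>z n\<close>, which are numbered by
    \<open>e0\<close>.\<close>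
  define u where "u x = (if x \<in> U then prod_encode (Suc (d x), v (d x) x) else prod_encode (0, e0 x))" for x
  have "inj_on u X"
  proof (rule inj_onI)
    fix x y assume xy: "x \<in> X" "y \<in> X" "u x = u y"
    show "x = y"
    proof (cases "x \<in> U")
      case True
      then have "y \<in> U" "d y = d x" "v (d x) x = v (d x) y"
        using xy(3) by (auto simp: u_def split: if_splits)
      moreover have "x \<in> z (d x)" "y \<in> z (d y)" using True \<open>y \<in> U\<close> d(1) by (auto simp: U_def)
      ultimately show ?thesis using inj[of "d x"] by (simp add: inj_on_def)
    next
      case False
      then have "e0 x = e0 y" using xy(3) by (auto simp: u_def split: if_splits)
      then show ?thesis using e0 xy by (simp add: inj_on_def)
    qed
  qed
  moreover have "comonotone u (v n) (X \<inter> z n)" for n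
  proof -
    have "comonotone u (v n) {x\<in>X \<inter> z n. d x = k}" for k
    proof -
      let ?S = "{x\<in>X \<inter> z n. d x = k}"
      have sub: "?S \<subseteq> z k \<inter> z n" using d(1) by blast
      have "comonotone u (v k) ?S"
      proof (rule comonotoneI)
        fix x y assume "x \<in> ?S" "y \<in> ?S"
        then have "u x = prod_encode (Suc k, v k x)" "u y = prod_encode (Suc k, v k y)"
          by (auto simp: u_def U_def)
        then show "u x < u y \<longleftrightarrow> v k x < v k y" by (simp add: prod_encode_less_iff)
      qed
      moreover have "comonotone (v k) (v n) ?S" by (rule comonotone_subset[OF coh sub])
      ultimately show ?thesis by (rule comonotone_trans)
    qed
    then have "comonotone u (v n) (\<Union>k\<in>{..n}. {x\<in>X \<inter> z n. d x = k})"
      by (intro comonotone_UN) auto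
    moreover have "X \<inter> z n \<subseteq> (\<Union>k\<in>{..n}. {x\<in>X \<inter> z n. d x = k})" using d(2) by auto
    ultimately show ?thesis by (rule comonotone_subset)
  qed
  ultimately show ?thesis by blast
qed

text \<open>Recursion along \<open>r\<close>: at \<open>X\<close>, the enumerations of the countably
  many controlling sets are amalgamated. Any other earlier \<open>Y\<close> with infinite trace on
  \<open>X\<close> has it inside some controlling \<open>Z \<subseteq> X\<close>, so comonotonicity
  with \<open>f Y\<close> is inherited through \<open>f Z\<close>.\<close>

lemma traceable_imp_coherent:
  fixes K :: "'a set"
  assumes tr: "traceable K r"
  shows "\<exists>e :: 'a set \<Rightarrow> 'a \<Rightarrow> nat. (\<forall>X\<in>ctbl_subsets K. inj_on (e X) X) \<and>
           (\<forall>X\<in>ctbl_subsets K. \<forall>Y\<in>ctbl_subsets K. comonotone (e X) (e Y) (X \<inter> Y))"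
proof -
  let ?P = "ctbl_subsets K"
  define step where "step f X u \<longleftrightarrow> (X \<in> ?P \<longrightarrow>
      inj_on u X \<and> (\<forall>Y\<in>?P. (Y, X) \<in> r \<longrightarrow> comonotone u (f Y) (X \<inter> Y)))"
    for f :: "'a set \<Rightarrow> 'a \<Rightarrow> nat" and X u
  have coh: "comonotone (f Y) (f Z) (Y \<inter> Z)"
    if "Y \<in> ?P" "Z \<in> ?P" "step f Y (f Y)" "step f Z (f Z)" for f Y Z
  proof (cases "Y = Z")
    case True
    then show ?thesis by (simp add: comonotone_refl)
  next
    case False
    then have "(Y, Z) \<in> r \<or> (Z, Y) \<in> r" by (rule traceableD(2)[OF tr that(1,2)])
    then show ?thesis
    proof
      assume "(Y, Z) \<in> r"
      then have "comonotone (f Z) (f Y) (Z \<inter> Y)" using that by (simp add: step_def)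
      then show ?thesis by (simp add: comonotone_sym Int_commute)
    next
      assume "(Z, Y) \<in> r"
      then show ?thesis using that by (simp add: step_def)
    qed
  qed
  have "\<exists>f. \<forall>X. step f X (f X)"
  proof (rule dependent_wf_choice[OF traceableD(1)[OF tr]])
    fix f g :: "'a set \<Rightarrow> 'a \<Rightarrow> nat" and X u
    assume "\<And>Z. (Z, X) \<in> r \<Longrightarrow> f Z = g Z"
    then show "step f X u = step g X u" by (simp add: step_def)
  next
    fix X f assume IH: "\<And>Y. (Y, X) \<in> r \<Longrightarrow> step f Y (f Y)"
    show "\<exists>u. step f X u"
    proof (cases "X \<in> ?P")
      case False
      then show ?thesis by (simp add: step_def)
    next
      case X: True
      obtain \<Z> where c\<Z>: "countable \<Z>" and \<Z>: "\<And>Z. Z \<in> \<Z> \<Longrightarrow> Z \<in> ?P \<and> (Z, X) \<in> r"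
        and trace: "\<And>Y. Y \<in> ?P \<Longrightarrow> (Y, X) \<in> r \<Longrightarrow> infinite (Y \<inter> X) \<Longrightarrow>
           Y \<in> \<Z> \<or> (\<exists>Z\<in>\<Z>. Y \<inter> X \<subseteq> Z \<and> Z \<subseteq> X)"
        using traceableD(3)[OF tr X] by metis
      \<comment> \<open>The empty set pads \<open>\<Z>\<close> so that it can be enumerated even
        when empty; coherence with it is vacuous.\<close>
      define z where "z = from_nat_into (insert {} \<Z>)"
      have range_z: "range z = insert {} \<Z>"
        unfolding z_def by (rule range_from_nat_into) (use c\<Z> in auto)
      have z: "z n = {} \<or> z n \<in> \<Z>" for n using rangeI[of z n] unfolding range_z by simp
      have "inj_on (f (z n)) (z n)" for n
        using z[of n] \<Z>[of "z n"] IH[of "z n"] by (auto simp: step_def)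
      moreover have "comonotone (f (z m)) (f (z n)) (z m \<inter> z n)" for m n
      proof (cases "z m \<in> \<Z> \<and> z n \<in> \<Z>")
        case True
        then show ?thesis using \<Z> IH by (intro coh) auto
      next
        case False
        then have "z m \<inter> z n = {}" using z[of m] z[of n] by auto
        then show ?thesis by (simp add: comonotone_finite)
      qed
      ultimately obtain u where u: "inj_on u X \<and> (\<forall>n. comonotone u (f (z n)) (X \<inter> z n))"
        using comonotone_amalgam[OF ctbl_subsetsD(2)[OF X], of "\<lambda>n. f (z n)" z] by metis
      have uZ: "comonotone u (f Z) (X \<inter> Z)" if "Z \<in> \<Z>" for Z
      proof -
        have "Z \<in> range z" using that by (simp add: range_z)
        then obtain n where "Z = z n" by (rule rangeE)
        then show ?thesis using u by simp
      qed
      have "comonotone u (f Y) (X \<inter> Y)" if Y: "Y \<in> ?P" "(Y, X) \<in> r" for Y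
      proof (cases "finite (X \<inter> Y)")
        case True
        then show ?thesis by (rule comonotone_finite)
      next
        case False
        then have "infinite (Y \<inter> X)" by (simp add: Int_commute)
        then have "Y \<in> \<Z> \<or> (\<exists>Z\<in>\<Z>. Y \<inter> X \<subseteq> Z \<and> Z \<subseteq> X)"
          by (rule trace[OF Y])
        then show ?thesis
        proof
          assume "Y \<in> \<Z>"
          then show ?thesis by (rule uZ)
        next
          assume "\<exists>Z\<in>\<Z>. Y \<inter> X \<subseteq> Z \<and> Z \<subseteq> X"
          then obtain Z where Z: "Z \<in> \<Z>" "Y \<inter> X \<subseteq> Z" "Z \<subseteq> X" by blast
          have "comonotone u (f Z) (X \<inter> Y)"
            by (rule comonotone_subset[OF uZ[OF Z(1)]]) (use Z in blast)
          moreover have "comonotone (f Z) (f Y) (Z \<inter> Y)"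
            using \<Z>[OF Z(1)] Y IH by (intro coh) auto
          then have "comonotone (f Z) (f Y) (X \<inter> Y)"
            by (rule comonotone_subset) (use Z in blast)
          ultimately show ?thesis by (rule comonotone_trans)
        qed
      qed
      then have "step f X u" using u by (simp add: step_def)
      then show ?thesis by (rule exI[of _ u])
    qed
  qed
  then obtain f where f: "\<And>X. step f X (f X)" by metis
  then have "\<forall>X\<in>?P. inj_on (f X) X" by (simp add: step_def)
  moreover have "\<forall>X\<in>?P. \<forall>Y\<in>?P. comonotone (f X) (f Y) (X \<inter> Y)" using coh f by blast
  ultimately show ?thesis by blast
qed

section \<open>Order-preserving and scrambling bijections of countable sets\<close>

lemma exists_monotone_enumeration:
  fixes a :: "'a \<Rightarrow> nat"
  assumes "inj_on a A" "infinite A"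
  shows "\<exists>b :: nat \<Rightarrow> 'a. bij_betw b UNIV A \<and> (\<forall>i j. a (b i) < a (b j) \<longleftrightarrow> i < j)"
proof -
  have inf: "infinite (a ` A)" using assms by (simp add: finite_image_iff)
  define b where "b = inv_into A a \<circ> enumerate (a ` A)"
  have "bij_betw b UNIV A"
    unfolding b_def
  proof (rule bij_betw_trans)
    show "bij_betw (enumerate (a ` A)) UNIV (a ` A)" by (rule bij_enumerate[OF inf])
    show "bij_betw (inv_into A a) (a ` A) A"
      by (rule bij_betw_inv_into) (simp add: bij_betw_def assms)
  qed
  moreover have "a (b i) = enumerate (a ` A) i" for i
    unfolding b_def using enumerate_in_set[OF inf] by (simp add: f_inv_into_f)
  ultimately show ?thesis using inf by (intro exI[of _ b]) simp
qed

lemma exists_monotone_bij: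
  fixes a :: "'a \<Rightarrow> nat"
  assumes "inj_on a A" "infinite A" "inj_on a B" "infinite B"
  shows "\<exists>h. bij_betw h A B \<and> (\<forall>x\<in>A. \<forall>y\<in>A. a (h x) < a (h y) \<longleftrightarrow> a x < a y)"
proof -
  obtain b :: "nat \<Rightarrow> 'a" where "bij_betw b UNIV A \<and> (\<forall>i j. a (b i) < a (b j) \<longleftrightarrow> i < j)"
    using exists_monotone_enumeration[OF assms(1,2)] ..
  then have b: "bij_betw b UNIV A" "\<And>i j. a (b i) < a (b j) \<longleftrightarrow> i < j"
    by simp_all
  obtain c :: "nat \<Rightarrow> 'a" where "bij_betw c UNIV B \<and> (\<forall>i j. a (c i) < a (c j) \<longleftrightarrow> i < j)"
    using exists_monotone_enumeration[OF assms(3,4)] ..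
  then have c: "bij_betw c UNIV B" "\<And>i j. a (c i) < a (c j) \<longleftrightarrow> i < j"
    by simp_all
  define h where "h = c \<circ> inv_into UNIV b"
  have "bij_betw h A B"
    unfolding h_def using bij_betw_inv_into[OF b(1)] c(1) by (rule bij_betw_trans)
  moreover have "a (h x) < a (h y) \<longleftrightarrow> a x < a y" if "x \<in> A" "y \<in> A" for x y
  proof -
    have "b (inv_into UNIV b x) = x" "b (inv_into UNIV b y) = y"
      using that b(1) by (auto simp: bij_betw_def f_inv_into_f)
    then show ?thesis using b(2)[of "inv_into UNIV b x" "inv_into UNIV b y"] by (simp add: h_def c(2))
  qed
  ultimately show ?thesis by blast
qed

lemma exists_not_comonotone_perm:
  fixes a :: "'a \<Rightarrow> nat"
  assumes "inj_on a A" "infinite A"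
  shows "\<exists>h. bij_betw h A A \<and> \<not> comonotone a (a \<circ> h) A"
proof -
  obtain b :: "nat \<Rightarrow> 'a" where "bij_betw b UNIV A \<and> (\<forall>i j. a (b i) < a (b j) \<longleftrightarrow> i < j)"
    using exists_monotone_enumeration[OF assms] ..
  then have b: "bij_betw b UNIV A" "\<And>i j. a (b i) < a (b j) \<longleftrightarrow> i < j"
    by simp_all
  \<comment> \<open>Swapping reverses each antidiagonal of the pairing function, so the permutation contains
    decreasing runs of every length.\<close>
  define p where "p = prod_encode \<circ> prod.swap \<circ> prod_decode"
  have "bij p"
    unfolding p_def by (intro bij_comp bij_prod_encode bij_prod_decode bij_swap)
  have pq: "p (prod_encode (m, n)) = prod_encode (n, m)" for m n by (simp add: p_def)
  define h where "h = b \<circ> p \<circ> inv_into UNIV b"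
  have bA: "b i \<in> A" for i using b(1) by (auto simp: bij_betw_def)
  have hb: "h (b i) = b (p i)" for i
    using b(1) by (simp add: h_def bij_betw_def inv_into_f_f)
  have "bij_betw h A A"
    unfolding h_def
    using bij_betw_trans[OF bij_betw_inv_into[OF b(1)] bij_betw_trans[OF \<open>bij p\<close> b(1)]]
    by (simp add: comp_assoc)
  moreover have "\<not> comonotone a (a \<circ> h) A"
  proof
    assume "comonotone a (a \<circ> h) A"
    then obtain c :: "'a \<Rightarrow> nat" where
      c: "finite (c ` A) \<and> (\<forall>x\<in>A. \<forall>y\<in>A. c x = c y \<longrightarrow> (a x < a y \<longleftrightarrow> (a \<circ> h) x < (a \<circ> h) y))"
      unfolding comonotone_def ..
    define N where "N = card (c ` A)"
    \<comment> \<open>The \<open>N + 1\<close> points \<open>q k\<close> come from one antidiagonal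
      and outnumber the colours, so two of them share a colour although the swap reverses their
      order.\<close>
    define q where "q k = b (prod_encode (k, N - k))" for k
    have "(\<lambda>k. c (q k)) ` {..N} \<subseteq> c ` A" using bA by (auto simp: q_def)
    then have "card ((\<lambda>k. c (q k)) ` {..N}) \<le> N" unfolding N_def using c by (intro card_mono) auto
    then have "\<not> inj_on (\<lambda>k. c (q k)) {..N}" by (intro pigeonhole) simp
    then obtain k l where kl: "k < l" "l \<le> N" "c (q k) = c (q l)"
      unfolding inj_on_def by (metis atMost_iff linorder_neqE_nat)
    have "a (q k) < a (q l)" using kl by (simp add: q_def b(2) prod_encode_def)
    moreover have "\<not> (a \<circ> h) (q k) < (a \<circ> h) (q l)"
      using kl by (simp add: q_def hb pq b(2)) (simp add: prod_encode_def)
    moreover have "q k \<in> A" "q l \<in> A" using bA by (simp_all add: q_def)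
    ultimately show False using c kl by blast
  qed
  ultimately show ?thesis by blast
qed

text \<open>A permutation of one countable \<open>Z\<close> that is monotone on two complementary
  pieces, extended by the identity, lies in \<open>G\<close> by coherence; this gives homogeneity. A
  permutation of a countable \<open>X\<close> that scrambles \<open>e X\<close> has no extension in
  \<open>G\<close>; this refutes transitivity.\<close>

lemma coherent_imp_HnT:
  fixes K :: "'a set" and e :: "'a set \<Rightarrow> 'a \<Rightarrow> nat"
  assumes unc: "uncountable K"
    and inj: "\<And>X. X \<in> ctbl_subsets K \<Longrightarrow> inj_on (e X) X"
    and coh: "\<And>X Y. X \<in> ctbl_subsets K \<Longrightarrow> Y \<in> ctbl_subsets K \<Longrightarrow> comonotone (e X) (e Y) (X \<inter> Y)"
  shows "HnT K"
proof -
  let ?P = "ctbl_subsets K"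
  define G where "G = {g\<in>Bij K. \<forall>X\<in>?P. comonotone (e X) (e (g ` X) \<circ> g) X}"
  have im: "g ` X \<in> ?P" if g: "g \<in> Bij K" and X: "X \<in> ?P" for g X
  proof (rule ctbl_subsetsI)
    have b: "inj_on g K" "g ` K = K" using g by (auto simp: Bij_def bij_betw_def)
    have XK: "X \<subseteq> K" "countable X" "infinite X" using ctbl_subsetsD[OF X] by auto
    show "g ` X \<subseteq> K" using XK b by blast
    show "countable (g ` X)" using XK by simp
    show "infinite (g ` X)" using XK b inj_on_subset finite_imageD by blast
  qed
  have "subgroup G (BijGroup K)"
  proof
    show "G \<subseteq> carrier (BijGroup K)" by (auto simp: G_def BijGroup_def)
  next
    fix h g assume h: "h \<in> G" and g: "g \<in> G"
    then have B: "h \<in> Bij K" "g \<in> Bij K" by (auto simp: G_def)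
    have "comonotone (e X) (e (compose K h g ` X) \<circ> compose K h g) X" if X: "X \<in> ?P" for X
    proof -
      have XK: "X \<subseteq> K" by (rule ctbl_subsetsD[OF X])
      have eq: "compose K h g ` X = h ` g ` X"
        using XK by (auto simp: compose_def image_def)
      have "comonotone (e X) (e (g ` X) \<circ> g) X" using g X by (simp add: G_def)
      moreover have "comonotone (e (g ` X)) (e (h ` g ` X) \<circ> h) (g ` X)"
        using h im[OF B(2) X] by (simp add: G_def)
      then have "comonotone (e (g ` X) \<circ> g) (e (h ` g ` X) \<circ> h \<circ> g) X"
        by (rule comonotone_comp) simp
      ultimately have "comonotone (e X) (e (h ` g ` X) \<circ> h \<circ> g) X" by (rule comonotone_trans)
      then show ?thesis
        unfolding eq by (rule comonotone_cong) (use XK in \<open>auto simp: compose_def\<close>)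
    qed
    then show "h \<otimes>\<^bsub>BijGroup K\<^esub> g \<in> G"
      using B by (simp add: G_def BijGroup_def compose_Bij)
  next
    have "comonotone (e X) (e ((\<lambda>x\<in>K. x) ` X) \<circ> (\<lambda>x\<in>K. x)) X" if X: "X \<in> ?P" for X
    proof -
      have XK: "X \<subseteq> K" by (rule ctbl_subsetsD[OF X])
      then have "(\<lambda>x\<in>K. x) ` X = X" by (auto simp: image_def)
      then show ?thesis using XK by (intro comonotoneI) auto
    qed
    then show "\<one>\<^bsub>BijGroup K\<^esub> \<in> G" by (simp add: G_def BijGroup_def id_Bij)
  next
    fix g assume g: "g \<in> G"
    then have B: "g \<in> Bij K" by (simp add: G_def)
    let ?i = "\<lambda>x\<in>K. inv_into K g x"
    have iB: "?i \<in> Bij K" by (rule restrict_inv_into_Bij[OF B])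
    have gi: "g (?i x) = x" if "x \<in> K" for x
      using that B by (auto simp: Bij_def bij_betw_def f_inv_into_f)
    have "comonotone (e Y) (e (?i ` Y) \<circ> ?i) Y" if Y: "Y \<in> ?P" for Y
    proof -
      have YK: "Y \<subseteq> K" by (rule ctbl_subsetsD[OF Y])
      have "g ` ?i ` Y = (\<lambda>x. x) ` Y"
        unfolding image_image using gi YK by (intro image_cong) auto
      then have eq: "g ` ?i ` Y = Y" by simp
      have "comonotone (e (?i ` Y)) (e (g ` ?i ` Y) \<circ> g) (?i ` Y)"
        using g im[OF iB Y] by (simp add: G_def)
      then have "comonotone (e (?i ` Y)) (e Y \<circ> g) (?i ` Y)" unfolding eq .
      then have "comonotone (e (?i ` Y) \<circ> ?i) (e Y \<circ> g \<circ> ?i) Y"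
        by (rule comonotone_comp) simp
      then have "comonotone (e (?i ` Y) \<circ> ?i) (e Y) Y"
        by (rule comonotone_cong) (use gi YK in auto)
      then show ?thesis by (rule comonotone_sym)
    qed
    then show "inv\<^bsub>BijGroup K\<^esub> g \<in> G"
      using B iB by (simp add: inv_BijGroup G_def)
  qed
  moreover have "omega_homogeneous K G"
    unfolding omega_homogeneous_def
  proof (intro ballI)
    fix X Y assume X: "X \<in> ?P" and Y: "Y \<in> ?P"
    have XK: "X \<subseteq> K" "countable X" "infinite X" using ctbl_subsetsD[OF X] by auto
    have YK: "Y \<subseteq> K" "countable Y" "infinite Y" using ctbl_subsetsD[OF Y] by auto
    \<comment> \<open>A spare infinite set \<open>E\<close> makes both complements in
      \<open>Z\<close> infinite, so that a monotone bijection between them exists as well.\<close>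
    have "infinite (K - (X \<union> Y))"
      using unc XK YK by (metis countable_Un countable_finite uncountable_minus_countable)
    then obtain E where E: "countable E" "infinite E" "E \<subseteq> K - (X \<union> Y)"
      using infinite_countable_subset' by metis
    define Z where "Z = X \<union> Y \<union> E"
    have Z: "Z \<in> ?P" using XK YK E by (intro ctbl_subsetsI) (auto simp: Z_def)
    have ZK: "Z \<subseteq> K" by (rule ctbl_subsetsD[OF Z])
    have sub: "X \<subseteq> Z" "Y \<subseteq> Z" by (auto simp: Z_def)
    have inf: "infinite (Z - X)" "infinite (Z - Y)"
      using E finite_subset[of E "Z - X"] finite_subset[of E "Z - Y"] by (auto simp: Z_def)
    have inja: "inj_on (e Z) S" if "S \<subseteq> Z" for S using inj[OF Z] that by (rule inj_on_subset)
    obtain h1 where h1: "bij_betw h1 X Y" "\<And>x y. x \<in> X \<Longrightarrow> y \<in> X \<Longrightarrow> e Z (h1 x) < e Z (h1 y) \<longleftrightarrow> e Z x < e Z y"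
      using exists_monotone_bij[of "e Z" X Y] inja sub XK YK by metis
    obtain h2 where h2: "bij_betw h2 (Z - X) (Z - Y)"
      "\<And>x y. x \<in> Z - X \<Longrightarrow> y \<in> Z - X \<Longrightarrow> e Z (h2 x) < e Z (h2 y) \<longleftrightarrow> e Z x < e Z y"
      using exists_monotone_bij[of "e Z" "Z - X" "Z - Y"] inja inf by (metis Diff_subset)
    \<comment> \<open>The value \<open>undefined\<close> outside \<open>K\<close> is forced by the
      extensionality of the elements of \<open>Bij K\<close>.\<close>
    define g where "g x = (if x \<in> X then h1 x else if x \<in> Z then h2 x else if x \<in> K then x else undefined)" for x
    have b1: "bij_betw g X Y" using h1(1) by (rule bij_betw_cong[THEN iffD1, rotated]) (simp add: g_def)
    have b2: "bij_betw g (Z - X) (Z - Y)"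
      using h2(1) by (rule bij_betw_cong[THEN iffD1, rotated]) (simp add: g_def)
    have "bij_betw id (K - Z) (K - Z)" by simp
    then have b3: "bij_betw g (K - Z) (K - Z)"
      by (rule bij_betw_cong[THEN iffD1, rotated]) (use sub in \<open>auto simp: g_def\<close>)
    have "bij_betw g (X \<union> (Z - X)) (Y \<union> (Z - Y))" using b1 b2 by (rule bij_betw_combine) blast
    then have "bij_betw g Z Z" using sub by (simp add: Un_absorb1)
    then have "bij_betw g (Z \<union> (K - Z)) (Z \<union> (K - Z))" using b3 by (rule bij_betw_combine) blast
    then have "bij_betw g K K" using ZK by (simp add: Un_absorb1)
    moreover have "g \<in> extensional K" using sub ZK by (auto simp: g_def extensional_def)
    ultimately have gB: "g \<in> Bij K" by (simp add: Bij_def)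
    have "comonotone (e W) (e (g ` W) \<circ> g) W" if W: "W \<in> ?P" for W
    proof -
      have gW: "g ` W \<in> ?P" by (rule im[OF gB W])
      \<comment> \<open>On a piece inside \<open>Z\<close>, the comparison passes from
        \<open>e W\<close> to \<open>e Z\<close>, then along \<open>g\<close> within
        \<open>Z\<close>, and finally by coherence at the image points to the enumeration of the
        image of \<open>W\<close>.\<close>
      have part: "comonotone (e W) (e (g ` W) \<circ> g) (W \<inter> A)"
        if A: "A \<subseteq> Z" "g ` A \<subseteq> Z" and mono: "\<And>x y. x \<in> A \<Longrightarrow> y \<in> A \<Longrightarrow> e Z x < e Z y \<longleftrightarrow> e Z (g x) < e Z (g y)"
        for A
      proof -
        have "comonotone (e W) (e Z) (W \<inter> A)"
          by (rule comonotone_subset[OF coh[OF W Z]]) (use A in blast)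
        moreover have "comonotone (e Z) (e Z \<circ> g) (W \<inter> A)"
          by (rule comonotoneI) (use mono in auto)
        moreover have "comonotone (e Z \<circ> g) (e (g ` W) \<circ> g) (W \<inter> A)"
          by (rule comonotone_comp[OF coh[OF Z gW]]) (use A in blast)
        ultimately show ?thesis by (meson comonotone_trans)
      qed
      have "comonotone (e W) (e (g ` W) \<circ> g) (W \<inter> X)"
        using b1 sub h1(2) by (intro part) (auto simp: bij_betw_def g_def)
      moreover have "comonotone (e W) (e (g ` W) \<circ> g) (W \<inter> (Z - X))"
        using b2 h2(2) by (intro part) (auto simp: bij_betw_def g_def)
      moreover have "comonotone (e W) (e (g ` W) \<circ> g) (W - Z)"
      proof -
        have fixed: "g x = x" if "x \<in> W - Z" for x
          using that ctbl_subsetsD(1)[OF W] sub by (auto simp: g_def)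
        have "W - Z \<subseteq> W \<inter> g ` W"
        proof
          fix x assume x: "x \<in> W - Z"
          then have "g x \<in> g ` W" by blast
          then show "x \<in> W \<inter> g ` W" using x fixed[OF x] by simp
        qed
        then have "comonotone (e W) (e (g ` W)) (W - Z)"
          by (rule comonotone_subset[OF coh[OF W gW]])
        then show ?thesis by (rule comonotone_cong) (use fixed in auto)
      qed
      ultimately have "comonotone (e W) (e (g ` W) \<circ> g) (W \<inter> X \<union> W \<inter> (Z - X) \<union> (W - Z))"
        by (intro comonotone_Un)
      then show ?thesis by (rule comonotone_subset) blast
    qed
    then have "g \<in> G" using gB by (simp add: G_def)
    moreover have "g ` X = Y" using b1 by (simp add: bij_betw_def)
    ultimately show "\<exists>g\<in>G. g ` X = Y" by blast
  qed
  moreover have "\<not> omega_transitive K G"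
  proof
    assume trans: "omega_transitive K G"
    have "infinite K" using unc countable_finite by blast
    then obtain X where X: "X \<subseteq> K" "countable X" "infinite X"
      using infinite_countable_subset' by metis
    then have XP: "X \<in> ?P" by (simp add: ctbl_subsetsI)
    obtain h where h: "bij_betw h X X" "\<not> comonotone (e X) (e X \<circ> h) X"
      using exists_not_comonotone_perm[OF inj[OF XP] X(3)] by metis
    have "inj_on h X \<and> X \<union> h ` X \<in> ?P" using h(1) XP by (simp add: bij_betw_def)
    then obtain g where g: "g \<in> G" "\<forall>x\<in>X. g x = h x"
      using trans unfolding omega_transitive_def by metis
    \<comment> \<open>Since \<open>h\<close> maps \<open>X\<close> onto itself, membership of
      \<open>g\<close> in \<open>G\<close> compares \<open>e X\<close> with itself.\<close>
    have "g ` X = h ` X" using g(2) by (intro image_cong) auto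
    then have "g ` X = X" using h(1) by (simp add: bij_betw_def)
    moreover have "comonotone (e X) (e (g ` X) \<circ> g) X" using g(1) XP by (simp add: G_def)
    ultimately have "comonotone (e X) (e X \<circ> g) X" by simp
    then have "comonotone (e X) (e X \<circ> h) X" by (rule comonotone_cong) (use g(2) in auto)
    then show False using h(2) by blast
  qed
  ultimately show ?thesis unfolding HnT_def by blast
qed

section \<open>Splendid spaces\<close>

text \<open>The complement of \<open>Z\<close> is added to the cover and discarded from the finite
  subcover.\<close>

lemma countably_compact_closed_subcover:
  assumes cc: "countably_compact_space X" and Z: "closedin X Z"
    and I: "countable I" "\<And>i. i \<in> I \<Longrightarrow> openin X (U i)" "Z \<subseteq> (\<Union>i\<in>I. U i)"
  shows "\<exists>J\<subseteq>I. finite J \<and> Z \<subseteq> (\<Union>i\<in>J. U i)"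
proof -
  let ?\<U> = "insert (topspace X - Z) (U ` I)"
  have "countable ?\<U> \<and> (\<forall>V\<in>?\<U>. openin X V) \<and> topspace X \<subseteq> \<Union>?\<U>"
    using I Z by auto
  then obtain \<F> where \<F>: "\<F> \<subseteq> ?\<U> \<and> finite \<F> \<and> topspace X \<subseteq> \<Union>\<F>"
    using cc unfolding countably_compact_space_def by metis
  have "\<F> - {topspace X - Z} \<subseteq> U ` I" "finite (\<F> - {topspace X - Z})" using \<F> by auto
  then obtain J where J: "J \<subseteq> I" "finite J" "\<F> - {topspace X - Z} = U ` J"
    by (meson finite_subset_image)
  have "Z \<subseteq> \<Union>(U ` J)"
    unfolding J(3)[symmetric]
  proof
    fix z assume z: "z \<in> Z"
    then have "z \<in> topspace X" using closedin_subset[OF Z] by blast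
    then obtain V where "V \<in> \<F>" "z \<in> V" using \<F> by blast
    then show "z \<in> \<Union>(\<F> - {topspace X - Z})" using z by blast
  qed
  then show ?thesis using J by blast
qed

text \<open>A countable closed neighbourhood \<open>C\<close> is regular and Lindelof, hence normal,
  and carries a Urysohn function. Its countable range omits some \<open>t\<close> between 0 and 1,
  so the sublevel set at \<open>t\<close> is both open and closed.\<close>

lemma countable_clopen_neighbourhood:
  assumes reg: "regular_space X" and lc: "locally_countable X" and x: "x \<in> topspace X"
  shows "\<exists>W. openin X W \<and> closedin X W \<and> countable W \<and> x \<in> W"
proof -
  obtain U where U: "openin X U" "x \<in> U" "countable U"
    using lc x unfolding locally_countable_def by blast
  have "neighbourhood_base_of (closedin X) X" using reg by (simp add: neighbourhood_base_of_closedin)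
  then obtain V C where VC: "openin X V" "closedin X C" "x \<in> V" "V \<subseteq> C" "C \<subseteq> U"
    unfolding neighbourhood_base_of using U by meson
  have cC: "countable C" using VC U countable_subset by blast
  let ?S = "subtopology X C"
  have CX: "C \<subseteq> topspace X" by (rule closedin_subset[OF VC(2)])
  have ts: "topspace ?S = C" using CX by (simp add: Int_absorb1)
  have "normal_space ?S"
    using cC reg ts
    by (intro regular_Lindelof_imp_normal_space regular_space_subtopology countable_imp_Lindelof_space) auto
  moreover have "closedin ?S (C - V)"
  proof -
    have "openin ?S V" using VC by (simp add: openin_subtopology_alt) blast
    then show ?thesis using closedin_diff[OF closedin_topspace] ts by metis
  qed
  moreover have "\<exists>T. closedin ?S T \<and> x \<in> T \<and> disjnt T (C - V)"
  proof -
    have "neighbourhood_base_of (closedin ?S) ?S"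
      using reg by (simp add: neighbourhood_base_of_closedin regular_space_subtopology)
    moreover have "openin ?S V" using VC by (simp add: openin_subtopology_alt) blast
    ultimately obtain V' T where "closedin ?S T" "x \<in> V'" "V' \<subseteq> T" "T \<subseteq> V"
      unfolding neighbourhood_base_of using VC(3) by meson
    then show ?thesis by (intro exI[of _ T]) (auto simp: disjnt_def)
  qed
  then obtain T where "closedin ?S T" "x \<in> T" "disjnt T (C - V)" by blast
  ultimately obtain f where f: "continuous_map ?S euclideanreal f" "f ` T \<subseteq> {0}" "f ` (C - V) \<subseteq> {1 :: real}"
    using Urysohn_lemma_alt[of ?S T "C - V" 0 1] by blast
  have "uncountable {0 <..< 1 :: real}" by (simp add: uncountable_open_interval)
  moreover have "countable (f ` C)" using cC by simp
  ultimately have "{0 <..< 1} - f ` C \<noteq> {}" using countable_subset by (metis Diff_eq_empty_iff)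
  then obtain t where "t \<in> {0 <..< 1} - f ` C" by blast
  then have t: "0 < t" "t < 1" "t \<notin> f ` C" by simp_all
  define W where "W = {y \<in> C. f y < t}"
  have W1: "W = {y \<in> topspace ?S. f y \<in> {..<t}}" using ts by (simp add: W_def)
  have W2: "W = {y \<in> topspace ?S. f y \<in> {..t}}"
    unfolding ts W_def using t(3) by (auto simp: less_le)
  have WV: "W \<subseteq> V" using f(3) t by (auto simp: W_def)
  have "openin ?S W" unfolding W1 by (rule openin_continuous_map_preimage[OF f(1)]) simp
  then obtain O' where "openin X O'" "W = O' \<inter> C" by (auto simp: openin_subtopology)
  \<comment> \<open>\<open>W\<close> misses \<open>C - V\<close>, where \<open>f\<close> is 1, so
    openness in \<open>C\<close> becomes openness in the whole space through the open set
    \<open>V\<close>.\<close>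
  then have "W = O' \<inter> V" using WV VC by blast
  then have "openin X W" using \<open>openin X O'\<close> VC by (simp add: openin_Int)
  moreover have "closedin ?S W" unfolding W2 by (rule closedin_continuous_map_preimage[OF f(1)]) simp
  then have "closedin X W" using VC(2) by (rule closedin_trans_full)
  moreover have "countable W" using cC by (simp add: W_def)
  moreover have "x \<in> W" using \<open>x \<in> T\<close> f(2) VC t by (auto simp: W_def)
  ultimately show ?thesis by blast
qed

section \<open>Countable clopen sets in a splendid space: cofinality and traces\<close>

definition countable_clopens :: "'b topology \<Rightarrow> 'b set set" where
  "countable_clopens X = {W. openin X W \<and> closedin X W \<and> countable W}"

text \<open>The closure of \<open>Y\<close> is countable by fairness, so countably many countable
  clopen neighbourhoods cover it. Countable compactness leaves finitely many, whose union is again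
  countable and clopen.\<close>

lemma countable_clopens_cofinal:
  assumes X: "splendid X" and Y: "Y \<in> ctbl_subsets (topspace X)"
  shows "\<exists>W\<in>countable_clopens X. Y \<subseteq> W"
proof -
  have reg: "regular_space X" and cc: "countably_compact_space X" and lc: "locally_countable X"
    and "omega_fair X" using X by (auto simp: splendid_def)
  define Z where "Z = X closure_of Y"
  have Z: "closedin X Z" "countable Z" "Y \<subseteq> Z" "Z \<subseteq> topspace X"
    using Y \<open>omega_fair X\<close> ctbl_subsetsD(1)[OF Y]
    by (auto simp: omega_fair_def Z_def closure_of_subset closure_of_subset_topspace[THEN subsetD])
  have "\<forall>z\<in>topspace X. \<exists>W. W \<in> countable_clopens X \<and> z \<in> W"
    using countable_clopen_neighbourhood[OF reg lc] unfolding countable_clopens_def by blast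
  then obtain W where W: "\<And>z. z \<in> topspace X \<Longrightarrow> W z \<in> countable_clopens X \<and> z \<in> W z" by metis
  have "\<exists>J\<subseteq>Z. finite J \<and> Z \<subseteq> (\<Union>i\<in>J. W i)"
    by (rule countably_compact_closed_subcover[OF cc Z(1,2)])
       (use W Z in \<open>auto simp: countable_clopens_def\<close>)
  then obtain J where J: "J \<subseteq> Z" "finite J" "Z \<subseteq> (\<Union>i\<in>J. W i)" by blast
  have WJ: "W j \<in> countable_clopens X" if "j \<in> J" for j using W J Z that by blast
  have "(\<Union>i\<in>J. W i) \<in> countable_clopens X"
    using WJ J(2) by (auto simp: countable_clopens_def countable_finite intro!: closedin_Union)
  then show ?thesis using J Z by blast
qed

text \<open>A separating pair of open sets is fixed for any two points. For clopen \<open>A\<close>,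
  both parts \<open>Z - A\<close> and \<open>Z \<inter> A\<close> of the countable closure
  \<open>Z\<close> are closed, so finite subcovers express the trace of \<open>A\<close> as a finite
  combination of the sets \<open>U x y\<close> with \<open>x\<close> and \<open>y\<close> in
  \<open>Z\<close>. There are only countably many such combinations.\<close>

lemma countable_clopen_traces:
  assumes X: "splendid X" and Y: "Y \<in> ctbl_subsets (topspace X)"
  shows "countable ((\<lambda>A. Y \<inter> A) ` countable_clopens X)"
proof -
  have cc: "countably_compact_space X" and "omega_fair X" and haus: "Hausdorff_space X"
    using X by (auto simp: splendid_def regular_t1_imp_Hausdorff_space)
  define Z where "Z = X closure_of Y"
  have Z: "closedin X Z" "countable Z" "Y \<subseteq> Z" "Z \<subseteq> topspace X"
    using Y \<open>omega_fair X\<close> ctbl_subsetsD(1)[OF Y]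
    by (auto simp: omega_fair_def Z_def closure_of_subset closure_of_subset_topspace[THEN subsetD])
  have "\<exists>U V. x \<in> topspace X \<and> y \<in> topspace X \<and> x \<noteq> y \<longrightarrow>
      openin X U \<and> openin X V \<and> x \<in> U \<and> y \<in> V \<and> disjnt U V" for x y
    using haus unfolding Hausdorff_space_def by meson
  then obtain U V where UV: "\<And>x y. x \<in> topspace X \<Longrightarrow> y \<in> topspace X \<Longrightarrow> x \<noteq> y \<Longrightarrow>
      openin X (U x y) \<and> openin X (V x y) \<and> x \<in> U x y \<and> y \<in> V x y \<and> disjnt (U x y) (V x y)"
    by metis
  \<comment> \<open>A code \<open>\<P>\<close> lists finitely many centres, each with a finite set
    of points to be separated from it; \<open>T\<close> turns it into a subset of
    \<open>Y\<close>.\<close>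
  define T where "T \<P> = Y \<inter> (\<Union>(x, E)\<in>\<P>. \<Inter>y\<in>E. U x y)" for \<P>
  define \<Q> where "\<Q> = {\<P>. finite \<P> \<and> \<P> \<subseteq> Z \<times> {E. finite E \<and> E \<subseteq> Z}}"
  have "countable \<Q>"
    unfolding \<Q>_def
    by (intro countable_Collect_finite_subset countable_SIGMA Z(2))
  moreover have "Y \<inter> A \<in> T ` \<Q>" if A: "A \<in> countable_clopens X" for A
  proof -
    have Ao: "openin X A" and Ac: "closedin X A" using A by (auto simp: countable_clopens_def)
    have c1: "closedin X (Z - A)" using Z(1) Ao by (rule closedin_diff)
    have c2: "closedin X (Z \<inter> A)" using Z(1) Ac by (rule closedin_Int)
    have "\<exists>E\<subseteq>Z - A. finite E \<and> Z - A \<subseteq> (\<Union>y\<in>E. V x y)" if x: "x \<in> Z \<inter> A" for x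
    proof (rule countably_compact_closed_subcover[OF cc c1])
      show "countable (Z - A)" using Z(2) by simp
      have *: "openin X (V x y) \<and> y \<in> V x y" if "y \<in> Z - A" for y
      proof -
        have "x \<in> topspace X" "y \<in> topspace X" "x \<noteq> y" using x that Z(4) by auto
        then show ?thesis using UV by blast
      qed
      then show "openin X (V x y)" if "y \<in> Z - A" for y using that by blast
      show "Z - A \<subseteq> (\<Union>y\<in>Z - A. V x y)" using * by blast
    qed
    then obtain E where E: "\<And>x. x \<in> Z \<inter> A \<Longrightarrow>
        E x \<subseteq> Z - A \<and> finite (E x) \<and> Z - A \<subseteq> (\<Union>y\<in>E x. V x y)" by metis
    \<comment> \<open>The factor \<open>topspace X\<close> matters when \<open>E x\<close> is empty
      and the intersection is the whole type.\<close>
    define N where "N x = topspace X \<inter> (\<Inter>y\<in>E x. U x y)" for x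
    have sep: "openin X (U x y) \<and> x \<in> U x y \<and> disjnt (U x y) (V x y)" if "x \<in> Z \<inter> A" "y \<in> E x" for x y
    proof -
      have "x \<in> topspace X" "y \<in> topspace X" "x \<noteq> y" using that E[OF that(1)] Z(4) by auto
      then show ?thesis using UV by blast
    qed
    have N: "openin X (N x)" "x \<in> N x" "N x \<inter> Z \<subseteq> A" if x: "x \<in> Z \<inter> A" for x
    proof -
      have "openin X (topspace X \<inter> \<Inter>((\<lambda>y. U x y) ` E x))"
        using E[OF x] sep[OF x] by (intro openin_Int_Inter) auto
      then show "openin X (N x)" by (simp add: N_def)
      show "x \<in> N x" using sep[OF x] x Z by (auto simp: N_def)
      show "N x \<inter> Z \<subseteq> A"
      proof
        fix z assume z: "z \<in> N x \<inter> Z"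
        show "z \<in> A"
        proof (rule ccontr)
          assume "z \<notin> A"
          then obtain y where y: "y \<in> E x" "z \<in> V x y" using z E[OF x] by blast
          then have "z \<in> U x y" using z by (auto simp: N_def)
          then show False using sep[OF x y(1)] y(2) by (auto simp: disjnt_def)
        qed
      qed
    qed
    have "\<exists>J\<subseteq>Z \<inter> A. finite J \<and> Z \<inter> A \<subseteq> (\<Union>x\<in>J. N x)"
      by (rule countably_compact_closed_subcover[OF cc c2]) (use N Z(2) in auto)
    then obtain J where J: "J \<subseteq> Z \<inter> A" "finite J" "Z \<inter> A \<subseteq> (\<Union>x\<in>J. N x)" by blast
    define \<P> where "\<P> = (\<lambda>x. (x, E x)) ` J"
    have "\<P> \<subseteq> Z \<times> {E. finite E \<and> E \<subseteq> Z}"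
      unfolding \<P>_def using J(1) E by blast
    then have "\<P> \<in> \<Q>" using J(2) by (simp add: \<Q>_def \<P>_def)
    moreover have "T \<P> = Y \<inter> (\<Union>x\<in>J. N x)"
      using Z by (auto simp: T_def \<P>_def N_def)
    moreover have "Y \<inter> (\<Union>x\<in>J. N x) = Y \<inter> A" using J N(3) Z(3) by blast
    ultimately show ?thesis by (metis image_eqI)
  qed
  ultimately show ?thesis by (meson countable_image countable_subset image_subsetI)
qed

text \<open>\<open>K\<close> is embedded into the space and the countable clopen sets are pulled
  back. Injectivity keeps the pullbacks countable, and traces on \<open>Y\<close> are determined by
  traces on its image.\<close>

lemma splendid_imp_CLS:
  fixes X :: "'b topology" and K :: "'a set"
  assumes X: "splendid X" and le: "card_of K \<le>o card_of (topspace X)"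
  shows "CLS K"
proof -
  obtain h where h: "inj_on h K" "h ` K \<subseteq> topspace X"
    using le by (auto simp flip: card_of_ordLeq)
  have hP: "h ` Y \<in> ctbl_subsets (topspace X)" if "Y \<in> ctbl_subsets K" for Y
  proof (rule ctbl_subsetsI)
    have Y: "Y \<subseteq> K" "countable Y" "infinite Y" using ctbl_subsetsD[OF that] by auto
    show "h ` Y \<subseteq> topspace X" using Y h by blast
    show "countable (h ` Y)" using Y by simp
    show "infinite (h ` Y)" using Y h inj_on_subset finite_imageD by blast
  qed
  define pb where "pb A = {k\<in>K. h k \<in> A}" for A
  \<comment> \<open>The intersection discards finite pullbacks.\<close>
  define \<A> where "\<A> = pb ` countable_clopens X \<inter> ctbl_subsets K"
  have "\<exists>A\<in>\<A>. Y \<subseteq> A" if Y: "Y \<in> ctbl_subsets K" for Y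
  proof -
    obtain W where W: "W \<in> countable_clopens X" "h ` Y \<subseteq> W"
      using countable_clopens_cofinal[OF X hP[OF Y]] by blast
    have sub: "Y \<subseteq> pb W" using W ctbl_subsetsD(1)[OF Y] by (auto simp: pb_def)
    have "h ` pb W \<subseteq> W" by (auto simp: pb_def)
    then have "countable (h ` pb W)"
      using W by (auto simp: countable_clopens_def intro: countable_subset)
    then have "countable (pb W)"
      by (rule countable_image_inj_on) (use h in \<open>auto simp: pb_def inj_on_def\<close>)
    moreover have "infinite (pb W)" using sub ctbl_subsetsD(3)[OF Y] finite_subset by blast
    ultimately have "pb W \<in> ctbl_subsets K" by (intro ctbl_subsetsI) (auto simp: pb_def)
    then show ?thesis using sub W by (auto simp: \<A>_def)
  qed
  moreover have "countable ((\<lambda>A. Y \<inter> A) ` \<A>)" if Y: "Y \<in> ctbl_subsets K" for Y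
  proof -
    have eq: "Y \<inter> pb W = Y \<inter> pb (h ` Y \<inter> W)" for W
      by (auto simp: pb_def)
    have "(\<lambda>A. Y \<inter> A) ` \<A> \<subseteq> (\<lambda>B. Y \<inter> pb B) ` (\<lambda>A. h ` Y \<inter> A) ` countable_clopens X"
    proof
      fix B assume "B \<in> (\<lambda>A. Y \<inter> A) ` \<A>"
      then obtain W where "W \<in> countable_clopens X" "B = Y \<inter> pb W" by (auto simp: \<A>_def)
      then show "B \<in> (\<lambda>B. Y \<inter> pb B) ` (\<lambda>A. h ` Y \<inter> A) ` countable_clopens X"
        using eq[of W] by blast
    qed
    moreover have "countable ((\<lambda>A. h ` Y \<inter> A) ` countable_clopens X)"
      by (rule countable_clopen_traces[OF X hP[OF Y]])
    ultimately show ?thesis by (meson countable_image countable_subset)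
  qed
  moreover have "\<A> \<subseteq> ctbl_subsets K" by (simp add: \<A>_def)
  ultimately show ?thesis
    unfolding CLS_def locally_small_def by (intro exI[of _ \<A>]) simp
qed

section \<open>The implications\<close>

theorem theorem9:
  fixes K :: "'a set"
  assumes GCH_a: "GCH_on (UNIV :: 'a set)"
    and GCH_pa: "GCH_on (UNIV :: 'a set set)"
    and GCH_b: "GCH_on (UNIV :: 'b set)"
    and K: "is_aleph_omega K"
  shows "(SPL K TYPE('b) \<longrightarrow> CLS K)
       \<and> (CLS K \<longrightarrow> wFN K)
       \<and> (wFN K \<longrightarrow> SAT K)
       \<and> (wFN K \<longrightarrow> Nt K)
       \<and> (wFN K \<longrightarrow> HnT K)"
proof (intro conjI impI)
  have CH: "CH_on K" by (rule GCH_on_imp_CH_on[OF GCH_a])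
  have unc: "uncountable K"
  proof
    assume "countable K"
    then have le: "card_of K \<le>o natLeq" by (simp add: countable_card_le_natLeq)
    have "above_all_alephs K" using K by (simp add: is_aleph_omega_def)
    \<comment> \<open>Level 0 of the aleph hierarchy already gives a set of size
      \<open>\<omega>\<close> strictly smaller than \<open>K\<close>.\<close>
    then obtain B :: "'a set" where "is_aleph 0 B \<and> card_of B <o card_of K"
      unfolding above_all_alephs_def by blast
    then have "card_of B =o natLeq" "card_of B <o card_of K" by simp_all
    then have "natLeq <o card_of K" by (rule ordIso_ordLess_trans[OF ordIso_symmetric])
    then show False using le not_ordLess_ordLeq by blast
  qed
  show "CLS K" if spl: "SPL K TYPE('b)"
  proof -
    obtain X :: "'b topology" where X: "splendid X \<and> card_of (topspace X) =o cardSuc (card_of K)"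
      using spl unfolding SPL_def ..
    have "card_of K \<le>o cardSuc (card_of K)" by (rule cardSuc_ordLeq[OF card_of_Card_order])
    then have "card_of K \<le>o card_of (topspace X)"
      using X ordIso_symmetric ordLeq_ordIso_trans by blast
    then show ?thesis using splendid_imp_CLS X by blast
  qed
  show "wFN K" if "CLS K" by (rule CLS_imp_wFN[OF CH that])
  show "SAT K" if "wFN K"
    using wFN_imp_traceable[OF CH that] traceable_imp_SAT by blast
  show "Nt K" if wFN: "wFN K"
  proof -
    obtain r where r: "traceable K r" using wFN_imp_traceable[OF CH wFN] ..
    show ?thesis
      using traceable_imp_sparse_cofinal[OF r] sparse_cofinal_imp_Nt[OF unc] by metis
  qed
  show "HnT K" if wFN: "wFN K"
  proof -
    obtain r where r: "traceable K r" using wFN_imp_traceable[OF CH wFN] ..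
    show ?thesis
      using traceable_imp_coherent[OF r] coherent_imp_HnT[OF unc] by metis
  qed
qed

end
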